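(* Let $B^0$ be an $n\times n$ exchange matrix of type $\mathrm{A}_n$, let $Q^0=Q(B^0)$, and let $C\subset[1,n]$ be a (nonempty) subset such that the subgraph of $Q^0$ induced by $C$ is a chain. Then the $\mathbf{g}$-vector of the cluster variable corresponding to $C$ (the cluster variable of $\mathcal{A}_\bullet(B^0,t_0)$ with denominator vector $\sum_{i\in C}\mathbf{e}_i$) is $(g_1,\dots,g_n)$, where - if $k\in C$, then $g_k=|I_{\rm out}(k)|-1$, where $I_{\rm out}(k)=\{j\in C: k\to j\text{ in }Q^0\}$; - if $k\notin C$, the subgraph of $Q^0$ induced by $C\cup\{k\}$ is a chain, and $k\to j$ in $Q^0$ for some $j\in C$, then $g_k=1$; - otherwise, $g_k=0$.
   Context: Notation: $[i,j]=\{k\in\mathbb{Z}: i\le k\le j\}$; $[x]_+=\max(x,0)$; $\mathbf{e}_i$ are standard basis vectors. Mutation of an $m\times n$ integer matrix $\tilde B=(b_{ij})$ ($m\ge n$) in direction $k\in[1,n]$: $b'_{ij}=-b_{ij}$ if $i=k$ or $j=k$, and $b'_{ij}=b_{ij}+\mathrm{sgn}(b_{ik})[b_{ik}b_{kj}]_+$ otherwise. An $n\times n$ exchange matrix of type $\mathrm{A}_n$ is a matrix obtained by a sequence of matrix mutations from the matrix $(b_{ij})$ with $b_{i,i+1}=1$, $b_{i,i-1}=-1$ and all other entries $0$. For a skew-symmetric integer matrix $B=(b_{ij})$, $Q(B)$ is the quiver on $[1,n]$ with $|b_{ij}|$ arrows from $i$ to $j$ if and only if $b_{ij}<0$. A chain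 is a path graph: vertices $v_1,\dots,v_p$ ($p\ge1$) distinct, with one edge joining $v_i$ and $v_{i+1}$ for $i=1,\dots,p-1$ and no other edges among them (orientations disregarded). $\mathbb{T}_n$ is the $n$-regular tree with edges labeled by $1,\dots,n$ so that the $n$ edges at each vertex have distinct labels; $t_0\in\mathbb{T}_n$. $\mathcal{A}_\bullet(B^0,t_0)$ is the cluster algebra with principal coefficients at $t_0$: the initial extended cluster is $(x_1,\dots,x_n,y_1,\dots,y_n)$ (free generators of a field of rational functions), the initial exchange matrix is $\left(\begin{smallmatrix}B^0\\ I\end{smallmatrix}\right)$, seed mutation of $((x_1,\dots,x_m),\tilde B)$ in direction $k\in[1,n]$ mutates $\tilde B$ and replaces only $x_k$, by $x_k'=x_k^{-1}(\prod_i x_i^{[b_{ik}]_+}+\prod_i x_i^{[-b_{ik}]_+})$, and seeds at vertices joined by an edge labeled $k$ are related by mutation in direction $k$; cluster variables are the first $n$ entries $x_{j;t}$ of the extended clusters. Each cluster variable lies in $\mathbb{Z}[x_1^{\pm1},\dots,x_n^{\pm1},y_1,\dots,y_n]$ and is homogeneous for the $\mathbb{Z}^n$-grading $\deg x_i=\mathbf{e}_i$, $\deg y_i=-(\text{$i$th column of }B^0)$; its degree is its $\mathbf{g}$-vector. Its denominator vector is $(d_1,\dots,d_n)$, where it is written as $N/(x_1^{d_1}\cdots x_n^{d_n})$ with $N$ a polynomial in $x_1,\dots,x_n$ (with coefficients Laurent polynomials in the $y_i$) not divisible by any $x_i$. In type $\mathrm{A}_n$, the map sending a cluster variable not in the initial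 cluster to its denominator vector is a bijection onto $\{\sum_{i\in C}\mathbf{e}_i\}$ with $C$ ranging over nonempty subsets of $[1,n]$ inducing a chain in $Q^0$. *)

theory Defs
  imports
    "HOL-Library.Poly_Mapping"
    "HOL-Computational_Algebra.Fraction_Field"
begin

text \<open>
  An \<open>m \<times> n\<close> integer matrix is a function \<open>nat \<Rightarrow> nat \<Rightarrow> int\<close> with rows indexed by \<open>[1,m]\<close> and
  columns by \<open>[1,n]\<close>. All matrices that occur below vanish outside this index range; mutation in a
  direction \<open>k \<in> [1,n]\<close> preserves this, so its defining formula needs no bounds on \<open>i\<close> and \<open>j\<close>.
\<close>

type_synonym imat = "nat \<Rightarrow> nat \<Rightarrow> int"

definition mutate_matrix :: "nat \<Rightarrow> imat \<Rightarrow> imat" where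
  "mutate_matrix k B = (\<lambda>i j.
     if i = k \<or> j = k then - B i j
     else B i j + sgn (B i k) * max (B i k * B k j) 0)"

definition linear_A_matrix :: "nat \<Rightarrow> imat" where
  "linear_A_matrix n = (\<lambda>i j.
     if i \<in> {1..n} \<and> j \<in> {1..n} then
       (if j = i + 1 then 1 else if i = j + 1 then -1 else 0)
     else 0)"

inductive exchange_matrix_type_A :: "nat \<Rightarrow> imat \<Rightarrow> bool" for n :: nat where
  base: "exchange_matrix_type_A n (linear_A_matrix n)"
| mutate: "exchange_matrix_type_A n B \<Longrightarrow> k \<in> {1..n} \<Longrightarrow>
    exchange_matrix_type_A n (mutate_matrix k B)"


text \<open>A quiver on \<open>[1,n]\<close> is given by its number of arrows from \<open>i\<close> to \<open>j\<close>.\<close>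

type_synonym quiver = "nat \<Rightarrow> nat \<Rightarrow> nat"

definition quiver_of :: "imat \<Rightarrow> quiver" where
  "quiver_of B = (\<lambda>i j. if B i j < 0 then nat \<bar>B i j\<bar> else 0)"

definition has_arrow :: "quiver \<Rightarrow> nat \<Rightarrow> nat \<Rightarrow> bool" where
  "has_arrow Q i j \<longleftrightarrow> Q i j > 0"

text \<open>
  \<open>induces_chain Q C\<close>: the subgraph of \<open>Q\<close> induced by \<open>C\<close> is a chain. The number of edges joining
  \<open>u\<close> and \<open>v\<close> is \<open>Q u v + Q v u\<close>, and the case \<open>i = j\<close> excludes loops.
\<close>

definition induces_chain :: "quiver \<Rightarrow> nat set \<Rightarrow> bool" where
  "induces_chain Q C \<longleftrightarrow>
     (\<exists>vs. vs \<noteq> [] \<and> distinct vs \<and> set vs = C \<and>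
        (\<forall>i<length vs. \<forall>j<length vs.
           Q (vs ! i) (vs ! j) + Q (vs ! j) (vs ! i) = (if j = i + 1 \<or> i = j + 1 then 1 else 0)))"


text \<open>
  The ambient field is the field of fractions of the polynomial ring over \<open>\<int>\<close> in variables
  indexed by \<open>nat\<close>. For rank \<open>n\<close> only the variables \<open>1, \<dots>, 2n\<close> are used: variable \<open>i\<close> is
  \<open>x\<^sub>i\<close> and variable \<open>n + i\<close> is \<open>y\<^sub>i\<close>, for \<open>i \<in> [1,n]\<close>.
\<close>

type_synonym ratfun = "((nat \<Rightarrow>\<^sub>0 nat) \<Rightarrow>\<^sub>0 int) fract"

definition gen :: "nat \<Rightarrow> ratfun" where
  "gen i = Fract (Poly_Mapping.single (Poly_Mapping.single i 1) 1) 1"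


text \<open>A seed consists of an extended cluster and an extended exchange matrix.\<close>

type_synonym seed = "(nat \<Rightarrow> ratfun) \<times> imat"

definition mutate_seed :: "nat \<Rightarrow> nat \<Rightarrow> seed \<Rightarrow> seed" where
  "mutate_seed m k s = (case s of (x, B) \<Rightarrow>
     (x(k := inverse (x k) *
          ((\<Prod>i=1..m. x i ^ nat (max (B i k) 0)) + (\<Prod>i=1..m. x i ^ nat (max (- B i k) 0)))),
      mutate_matrix k B))"

definition principal_extension :: "nat \<Rightarrow> imat \<Rightarrow> imat" where
  "principal_extension n B = (\<lambda>i j.
     if j \<in> {1..n} then
       (if i \<in> {1..n} then B i j else if i = n + j then 1 else 0)
     else 0)"

text \<open>
  The vertices of the \<open>n\<close>-regular tree are identified with the label sequences of the reduced
  paths that lead to them from \<open>t\<^sub>0 = []\<close>, the last label first: the edge labelled \<open>k\<close> at a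
  vertex \<open>w\<close> whose first letter is not \<open>k\<close> joins \<open>w\<close> to \<open>k # w\<close>. As seed mutations are involutive,
  attaching the seeds along these paths yields the seed pattern on the whole tree.
\<close>

definition tree_vertices :: "nat \<Rightarrow> nat list set" where
  "tree_vertices n = {w. set w \<subseteq> {1..n} \<and> distinct_adj w}"

primrec seed_at :: "nat \<Rightarrow> imat \<Rightarrow> nat list \<Rightarrow> seed" where
  "seed_at n B0 [] = (gen, principal_extension n B0)"
| "seed_at n B0 (k # w) = mutate_seed (2 * n) k (seed_at n B0 w)"

definition cluster_variables :: "nat \<Rightarrow> imat \<Rightarrow> ratfun set" where
  "cluster_variables n B0 = {fst (seed_at n B0 t) j | t j. t \<in> tree_vertices n \<and> j \<in> {1..n}}"


text \<open>
  Laurent polynomials over \<open>\<int>\<close> are finitely supported maps from exponent vectors to coefficients;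
  \<open>laurent_eval\<close> embeds them into the ambient field.
\<close>

definition laurent_eval :: "((nat \<Rightarrow>\<^sub>0 int) \<Rightarrow>\<^sub>0 int) \<Rightarrow> ratfun" where
  "laurent_eval p = (\<Sum>a\<in>Poly_Mapping.keys p.
     of_int (Poly_Mapping.lookup p a) *
     (\<Prod>i\<in>Poly_Mapping.keys a. gen i powi Poly_Mapping.lookup a i))"

definition laurent_span :: "(nat \<Rightarrow>\<^sub>0 int) set \<Rightarrow> ratfun set" where
  "laurent_span A = {laurent_eval p | p. Poly_Mapping.keys p \<subseteq> A}"

text \<open>
  The \<open>j\<close>-th component of the degree of the monomial with exponent vector \<open>a\<close>, where
  \<open>deg x\<^sub>i = e\<^sub>i\<close> and \<open>deg y\<^sub>i = - (i-th column of B0)\<close>.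
\<close>

definition monomial_degree :: "nat \<Rightarrow> imat \<Rightarrow> (nat \<Rightarrow>\<^sub>0 int) \<Rightarrow> nat \<Rightarrow> int" where
  "monomial_degree n B0 a j =
     Poly_Mapping.lookup a j - (\<Sum>i=1..n. Poly_Mapping.lookup a (n + i) * B0 j i)"

text \<open>
  Vectors in \<open>\<int>\<^sup>n\<close> are functions on \<open>nat\<close> of which only the values on \<open>[1,n]\<close> matter. The degree of
  a nonzero homogeneous element, and the denominator vector of a nonzero Laurent polynomial, are
  unique on \<open>[1,n]\<close>.
\<close>

definition has_g_vector :: "nat \<Rightarrow> imat \<Rightarrow> ratfun \<Rightarrow> (nat \<Rightarrow> int) \<Rightarrow> bool" where
  "has_g_vector n B0 z g \<longleftrightarrow> z \<noteq> 0 \<and>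
     z \<in> laurent_span {a. Poly_Mapping.keys a \<subseteq> {1..2*n} \<and>
                          (\<forall>j\<in>{1..n}. monomial_degree n B0 a j = g j)}"

text \<open>Polynomials in the \<open>x\<^sub>i\<close> whose coefficients are Laurent polynomials in the \<open>y\<^sub>i\<close>.\<close>

definition x_polynomials :: "nat \<Rightarrow> ratfun set" where
  "x_polynomials n = laurent_span {a. Poly_Mapping.keys a \<subseteq> {1..2*n} \<and>
                                      (\<forall>i\<in>{1..n}. 0 \<le> Poly_Mapping.lookup a i)}"

definition has_denominator_vector :: "nat \<Rightarrow> ratfun \<Rightarrow> (nat \<Rightarrow> int) \<Rightarrow> bool" where
  "has_denominator_vector n z d \<longleftrightarrow>
     (\<exists>N\<in>x_polynomials n.
        z = N / (\<Prod>i=1..n. gen i powi d i) \<and>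
        (\<forall>i\<in>{1..n}. \<not> (\<exists>M\<in>x_polynomials n. N = gen i * M)))"

end

theory Submission
  imports Defs
begin

text \<open>
  Seeds of type \<open>A\<^sub>n\<close> are modelled by labelled triangulations of an \<open>(n+3)\<close>-gon, mutation being the
  flip of a diagonal; the coefficient rows of the extended exchange matrix are the shear coordinates
  of the laminations obtained by shifting the diagonals of the initial triangulation. Cluster
  variables are subtraction-free, so every monomial valuation turns the exchange relations into
  tropical Ptolemy relations and is determined by them on all diagonals. The valuations of the
  variables \<open>x\<^sub>i\<close> give minus the crossing numbers with the initial diagonals. The \<open>j\<close>-th degree and
  its negative both take on a diagonal the value of an explicit shear coordinate, up to sign, so that
  every cluster variable is homogeneous of this degree. It remains to read off the shear coordinates
  of a diagonal from the set \<open>C\<close> of initial diagonals that it crosses.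
\<close>

section \<open>Monomial valuations of rational functions\<close>

text \<open>The Laurent property is contained in the hypothesis on the denominator vector, so only
  numbers remain to be found: one valuation of \<open>z\<close> for each weight. The difficulty is
  that tropical relations yield a minimum, whereas a degree has to be minimal and maximal at once.
  It is resolved by the shape of \<open>g_coord\<close>: moving the ends of \<open>pq\<close>
  forwards has the same effect as moving the sides of the quadrilateral around \<open>j\<close>
  backwards. Hence \<open>g_coord\<close> is half a signed sum of the laminations of four edges,
  evaluated at \<open>pq\<close>, and its signs are those of column \<open>j\<close> of
  \<open>B0\<close>. Each of these laminations satisfies the tropical Ptolemy relation, and adding
  them up shows that both monomials of an exchange relation have the same degree. The half-open arcs
  also settle the degenerate positions: for \<open>k\<close> outside \<open>C\<close> the coordinate
  is 1 only if \<open>pq\<close> shares an end with the diagonal \<open>k\<close>.\<close>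

type_synonym mpoly = "(nat \<Rightarrow>\<^sub>0 nat) \<Rightarrow>\<^sub>0 int"

definition weight :: "(nat \<Rightarrow> int) \<Rightarrow> (nat \<Rightarrow>\<^sub>0 nat) \<Rightarrow> int" where
  "weight w a = (\<Sum>i\<in>Poly_Mapping.keys a. int (Poly_Mapping.lookup a i) * w i)"

lemma weight_superset:
  assumes "finite S" "Poly_Mapping.keys a \<subseteq> S"
  shows "weight w a = (\<Sum>i\<in>S. int (Poly_Mapping.lookup a i) * w i)"
  unfolding weight_def using assms
  by (intro sum.mono_neutral_left) (auto simp: in_keys_iff)

lemma weight_add: "weight w (a + b) = weight w a + weight w b"
proof -
  let ?S = "Poly_Mapping.keys a \<union> Poly_Mapping.keys b"
  have "Poly_Mapping.keys (a + b) \<subseteq> ?S" by (rule keys_add)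
  then show ?thesis
    using weight_superset[of ?S "a + b" w] weight_superset[of ?S a w] weight_superset[of ?S b w]
    by (simp add: lookup_add distrib_right sum.distrib)
qed

lemma weight_single: "weight w (Poly_Mapping.single i m) = int m * w i"
  by (simp add: weight_def)

text \<open>The lowest degree occurring in \<open>N\<close> when variable \<open>i\<close> has
  degree \<open>w i\<close>. As a \<open>Min\<close> over the support it is meaningful only for
  nonzero \<open>N\<close>.\<close>

definition min_weight :: "(nat \<Rightarrow> int) \<Rightarrow> mpoly \<Rightarrow> int" where
  "min_weight w N = Min (weight w ` Poly_Mapping.keys N)"

lemma keys_nonempty: "N \<noteq> 0 \<Longrightarrow> Poly_Mapping.keys N \<noteq> {}"
  by (metis ex_in_conv in_keys_iff lookup_zero poly_mapping_eqI)

lemma min_weight_le: "a \<in> Poly_Mapping.keys N \<Longrightarrow> min_weight w N \<le> weight w a"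
  by (simp add: min_weight_def)

lemma min_weight_attained:
  assumes "N \<noteq> 0"
  obtains a where "a \<in> Poly_Mapping.keys N" "weight w a = min_weight w N"
proof -
  have "min_weight w N \<in> weight w ` Poly_Mapping.keys N"
    unfolding min_weight_def using keys_nonempty[OF assms] by (intro Min_in) auto
  then show thesis using that by auto
qed

lemma min_weight_eqI:
  assumes "a \<in> Poly_Mapping.keys N" "weight w a = m" "\<And>b. b \<in> Poly_Mapping.keys N \<Longrightarrow> m \<le> weight w b"
  shows "min_weight w N = m"
  unfolding min_weight_def using assms by (intro Min_eqI) auto

lemma poly_split:
  fixes N :: mpoly
  obtains N0 N1 where "N = N0 + N1"
    "Poly_Mapping.keys N0 = {a \<in> Poly_Mapping.keys N. P a}"
    "Poly_Mapping.keys N1 = {a \<in> Poly_Mapping.keys N. \<not> P a}"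
proof -
  define r where "r Q = Poly_Mapping.Abs_poly_mapping (\<lambda>a. if Q a then Poly_Mapping.lookup N a else 0)"
    for Q :: "(nat \<Rightarrow>\<^sub>0 nat) \<Rightarrow> bool"
  have r: "Poly_Mapping.lookup (r Q) a = (if Q a then Poly_Mapping.lookup N a else 0)" for Q a
  proof -
    have "finite {a. (if Q a then Poly_Mapping.lookup N a else 0) \<noteq> 0}"
      by (rule finite_subset[OF _ finite_keys[of N]]) (auto simp: in_keys_iff)
    then show ?thesis by (simp add: r_def)
  qed
  show thesis
    by (rule that[of "r P" "r (\<lambda>a. \<not> P a)"]) (auto intro!: poly_mapping_eqI simp: in_keys_iff lookup_add r split: if_splits)
qed

text \<open>The parts of minimal weight multiply to something nonzero, as there are no zero divisors.\<close>

lemma min_weight_mult: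
  assumes "N \<noteq> 0" "M \<noteq> 0"
  shows "min_weight w (N * M) = min_weight w N + min_weight w M"
proof -
  obtain N0 N1 where N: "N = N0 + N1"
      "Poly_Mapping.keys N0 = {a \<in> Poly_Mapping.keys N. weight w a = min_weight w N}"
      "Poly_Mapping.keys N1 = {a \<in> Poly_Mapping.keys N. weight w a \<noteq> min_weight w N}"
    by (rule poly_split)
  obtain M0 M1 where M: "M = M0 + M1"
      "Poly_Mapping.keys M0 = {a \<in> Poly_Mapping.keys M. weight w a = min_weight w M}"
      "Poly_Mapping.keys M1 = {a \<in> Poly_Mapping.keys M. weight w a \<noteq> min_weight w M}"
    by (rule poly_split)
  have "N0 \<noteq> 0" "M0 \<noteq> 0"
    using min_weight_attained[OF assms(1), of w] min_weight_attained[OF assms(2), of w] N(2) M(2)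
    by (metis (mono_tags, lifting) empty_iff keys_zero mem_Collect_eq)+
  then have "N0 * M0 \<noteq> 0" by simp
  then obtain c where c: "c \<in> Poly_Mapping.keys (N0 * M0)" using keys_nonempty by blast
  have wc: "weight w c = min_weight w N + min_weight w M"
    using c keys_mult[of N0 M0] by (auto simp: N M weight_add)
  have N1: "min_weight w N < weight w a" if "a \<in> Poly_Mapping.keys N1" for a
    using that min_weight_le[of a N w] by (auto simp: N)
  have M1: "min_weight w M < weight w a" if "a \<in> Poly_Mapping.keys M1" for a
    using that min_weight_le[of a M w] by (auto simp: M)
  have "c \<notin> Poly_Mapping.keys (N1 * M)"
  proof
    assume "c \<in> Poly_Mapping.keys (N1 * M)"
    then obtain a b where "c = a + b" "a \<in> Poly_Mapping.keys N1" "b \<in> Poly_Mapping.keys M"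
      using keys_mult[of N1 M] by auto
    then show False using N1[of a] min_weight_le[of b M w] wc by (simp add: weight_add)
  qed
  moreover have "c \<notin> Poly_Mapping.keys (N0 * M1)"
  proof
    assume "c \<in> Poly_Mapping.keys (N0 * M1)"
    then obtain a b where "c = a + b" "a \<in> Poly_Mapping.keys N0" "b \<in> Poly_Mapping.keys M1"
      using keys_mult[of N0 M1] by auto
    then show False using M1[of b] wc by (simp add: weight_add N)
  qed
  moreover have "N * M = N0 * M0 + (N1 * M + N0 * M1)"
    unfolding N(1) M(1) by (simp add: algebra_simps)
  ultimately have "c \<in> Poly_Mapping.keys (N * M)"
    using c by (simp add: in_keys_iff lookup_add)
  then show ?thesis
  proof (rule min_weight_eqI[OF _ wc])
    fix d assume "d \<in> Poly_Mapping.keys (N * M)"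
    then obtain a b where "d = a + b" "a \<in> Poly_Mapping.keys N" "b \<in> Poly_Mapping.keys M"
      using keys_mult[of N M] by auto
    then show "min_weight w N + min_weight w M \<le> weight w d"
      using min_weight_le[of a N w] min_weight_le[of b M w] by (simp add: weight_add)
  qed
qed

section \<open>Subtraction-free elements and the valuation of a sum\<close>

definition nonneg :: "mpoly \<Rightarrow> bool" where
  "nonneg N \<longleftrightarrow> (\<forall>a. 0 \<le> Poly_Mapping.lookup N a)"

lemma nonneg_add: "nonneg N \<Longrightarrow> nonneg M \<Longrightarrow> nonneg (N + M)"
  by (simp add: nonneg_def lookup_add)

lemma nonneg_mult:
  assumes "nonneg N" "nonneg M"
  shows "nonneg (N * M)"
proof -
  have *: "0 \<le> Sum_any f" if "\<And>x. 0 \<le> f x" for f :: "(nat \<Rightarrow>\<^sub>0 nat) \<Rightarrow> int"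
    using that by (simp add: Sum_any.expand_set sum_nonneg)
  show ?thesis
    using assms by (auto simp: nonneg_def lookup_mult when_def intro!: * mult_nonneg_nonneg)
qed

text \<open>Nonnegative coefficients cannot cancel. For this reason the valuation of a sum below is
  equal to the minimum, and not merely bounded by it.\<close>

lemma keys_add_nonneg:
  assumes "nonneg N" "nonneg M"
  shows "Poly_Mapping.keys (N + M) = Poly_Mapping.keys N \<union> Poly_Mapping.keys M"
  using assms by (auto simp: nonneg_def in_keys_iff lookup_add add_nonneg_eq_0_iff)

lemma min_weight_add_nonneg:
  assumes "nonneg N" "nonneg M" "N \<noteq> 0" "M \<noteq> 0"
  shows "min_weight w (N + M) = min (min_weight w N) (min_weight w M)"
  using assms keys_nonempty[of N] keys_nonempty[of M]
  by (simp add: min_weight_def keys_add_nonneg image_Un Min_Un)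

lemma add_nonneg_nonzero:
  assumes "nonneg N" "nonneg M" "N \<noteq> 0"
  shows "N + M \<noteq> 0"
  using keys_add_nonneg[OF assms(1,2)] keys_nonempty[OF assms(3)] by auto

text \<open>Independent of the chosen fraction because \<open>min_weight\<close> is additive on
  products; unspecified at 0.\<close>

definition val :: "(nat \<Rightarrow> int) \<Rightarrow> ratfun \<Rightarrow> int" where
  "val w z = (THE v. \<exists>N M. N \<noteq> 0 \<and> M \<noteq> 0 \<and> z = Fract N M \<and> v = min_weight w N - min_weight w M)"

lemma val_Fract:
  assumes "N \<noteq> 0" "M \<noteq> 0"
  shows "val w (Fract N M) = min_weight w N - min_weight w M"
  unfolding val_def
proof (rule the_equality)
  fix v assume "\<exists>N' M'. N' \<noteq> 0 \<and> M' \<noteq> 0 \<and> Fract N M = Fract N' M' \<and> v = min_weight w N' - min_weight w M'"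
  then obtain N' M' where *: "N' \<noteq> 0" "M' \<noteq> 0" "Fract N M = Fract N' M'" "v = min_weight w N' - min_weight w M'"
    by blast
  then have "min_weight w (N * M') = min_weight w (N' * M)" using assms by (simp add: eq_fract)
  then show "v = min_weight w N - min_weight w M" using * assms by (simp add: min_weight_mult)
qed (use assms in blast)

lemma Fract_nonzero_cases:
  fixes z :: ratfun
  assumes "z \<noteq> 0"
  obtains N M where "N \<noteq> 0" "M \<noteq> 0" "z = Fract N M"
  using assms by (metis Fract_cases_nonzero)

lemma val_mult:
  assumes "y \<noteq> 0" "z \<noteq> 0"
  shows "val w (y * z) = val w y + val w z"
proof -
  obtain N M where y: "N \<noteq> 0" "M \<noteq> 0" "y = Fract N M" using Fract_nonzero_cases[OF assms(1)] .
  obtain N' M' where z: "N' \<noteq> 0" "M' \<noteq> 0" "z = Fract N' M'" using Fract_nonzero_cases[OF assms(2)] .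
  show ?thesis using y z by (simp add: val_Fract min_weight_mult)
qed

lemma min_weight_one: "min_weight w 1 = 0"
  by (simp add: min_weight_def weight_def)

lemma val_one: "val w 1 = 0"
  using val_Fract[of 1 1 w] by (simp add: One_fract_def)

lemma val_inverse:
  assumes "z \<noteq> 0" shows "val w (inverse z) = - val w z"
  using val_mult[of z "inverse z" w] assms by (simp add: val_one)

lemma val_power:
  assumes "z \<noteq> 0" shows "val w (z ^ m) = int m * val w z"
  using assms by (induction m) (auto simp: val_one val_mult algebra_simps)

lemma val_powi:
  assumes "z \<noteq> 0" shows "val w (z powi m) = m * val w z"
  using assms by (auto simp: power_int_def val_power val_inverse)

lemma val_prod:
  assumes "finite A" "\<And>i. i \<in> A \<Longrightarrow> z i \<noteq> 0"
  shows "val w (\<Prod>i\<in>A. z i) = (\<Sum>i\<in>A. val w (z i))"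
  using assms by (induction A rule: finite_induct) (auto simp: val_one val_mult)

lemma single_nonzero: "Poly_Mapping.single a (c::int) \<noteq> 0 \<longleftrightarrow> c \<noteq> 0"
  by (metis lookup_single_eq lookup_zero single_zero)

lemma gen_nonzero: "gen i \<noteq> 0"
  by (simp add: gen_def Zero_fract_def eq_fract single_nonzero)

lemma val_gen: "val w (gen i) = w i"
  unfolding gen_def by (subst val_Fract) (auto simp: single_nonzero min_weight_one, simp add: min_weight_def weight_single)

text \<open>This class contains the initial variables and is closed under every operation of an
  exchange relation, so it contains all cluster variables.\<close>

definition subtraction_free :: "ratfun \<Rightarrow> bool" where
  "subtraction_free z \<longleftrightarrow> (\<exists>N M. nonneg N \<and> nonneg M \<and> N \<noteq> 0 \<and> M \<noteq> 0 \<and> z = Fract N M)"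

lemma subtraction_free_nonzero: "subtraction_free z \<Longrightarrow> z \<noteq> 0"
  by (auto simp: subtraction_free_def Zero_fract_def eq_fract)

lemma subtraction_free_mult: "subtraction_free y \<Longrightarrow> subtraction_free z \<Longrightarrow> subtraction_free (y * z)"
proof -
  assume "subtraction_free y" "subtraction_free z"
  then obtain N M N' M' where *: "nonneg N" "nonneg M" "N \<noteq> 0" "M \<noteq> 0" "y = Fract N M"
      "nonneg N'" "nonneg M'" "N' \<noteq> 0" "M' \<noteq> 0" "z = Fract N' M'"
    unfolding subtraction_free_def by blast
  show "subtraction_free (y * z)"
    unfolding subtraction_free_def
    by (rule exI[of _ "N * N'"], rule exI[of _ "M * M'"]) (use * in \<open>simp add: nonneg_mult\<close>)
qed

lemma subtraction_free_inverse: "subtraction_free z \<Longrightarrow> subtraction_free (inverse z)"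
  unfolding subtraction_free_def by (metis inverse_fract)

lemma nonneg_single: "0 \<le> c \<Longrightarrow> nonneg (Poly_Mapping.single a c)"
  by (simp add: nonneg_def lookup_single when_def)

lemma nonneg_one: "nonneg 1"
  by (simp add: nonneg_def lookup_one when_def)

lemma subtraction_free_one: "subtraction_free 1"
  unfolding subtraction_free_def One_fract_def using nonneg_one by (metis zero_neq_one)

lemma subtraction_free_gen: "subtraction_free (gen i)"
  unfolding subtraction_free_def gen_def
  by (intro exI[of _ "Poly_Mapping.single (Poly_Mapping.single i 1) 1"] exI[of _ 1])
    (auto simp: nonneg_single nonneg_one single_nonzero)

lemma subtraction_free_power: "subtraction_free z \<Longrightarrow> subtraction_free (z ^ m)"
  by (induction m) (auto simp: subtraction_free_one subtraction_free_mult)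

lemma subtraction_free_prod:
  "(\<And>i. i \<in> A \<Longrightarrow> subtraction_free (z i)) \<Longrightarrow> subtraction_free (\<Prod>i\<in>A. z i)"
  by (induction A rule: infinite_finite_induct) (auto simp: subtraction_free_one subtraction_free_mult)

lemma
  assumes "subtraction_free y" "subtraction_free z"
  shows subtraction_free_add: "subtraction_free (y + z)"
    and val_add: "val w (y + z) = min (val w y) (val w z)"
proof -
  obtain N M where y: "nonneg N" "nonneg M" "N \<noteq> 0" "M \<noteq> 0" "y = Fract N M"
    using assms(1) by (auto simp: subtraction_free_def)
  obtain N' M' where z: "nonneg N'" "nonneg M'" "N' \<noteq> 0" "M' \<noteq> 0" "z = Fract N' M'"
    using assms(2) by (auto simp: subtraction_free_def)
  have eq: "y + z = Fract (N * M' + N' * M) (M * M')" using y z by simp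
  have nz: "N * M' + N' * M \<noteq> 0"
    by (rule add_nonneg_nonzero) (use y z nonneg_mult in auto)
  show "subtraction_free (y + z)"
    unfolding subtraction_free_def eq
    by (rule exI[of _ "N * M' + N' * M"], rule exI[of _ "M * M'"])
      (use y z nz in \<open>simp add: nonneg_mult nonneg_add\<close>)
  show "val w (y + z) = min (val w y) (val w z)"
    unfolding eq using nz y z
    by (simp add: val_Fract min_weight_mult min_weight_add_nonneg nonneg_mult min_def)
qed

section \<open>Laurent polynomials and their valuations\<close>

definition laurent_monomial :: "(nat \<Rightarrow>\<^sub>0 int) \<Rightarrow> ratfun" where
  "laurent_monomial a = (\<Prod>i\<in>Poly_Mapping.keys a. gen i powi Poly_Mapping.lookup a i)"

lemma laurent_monomial_superset:
  assumes "finite S" "Poly_Mapping.keys a \<subseteq> S"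
  shows "laurent_monomial a = (\<Prod>i\<in>S. gen i powi Poly_Mapping.lookup a i)"
  unfolding laurent_monomial_def using assms
  by (intro prod.mono_neutral_left) (auto simp: in_keys_iff)

lemma laurent_monomial_add: "laurent_monomial (a + b) = laurent_monomial a * laurent_monomial b"
proof -
  let ?S = "Poly_Mapping.keys a \<union> Poly_Mapping.keys b"
  have "Poly_Mapping.keys (a + b) \<subseteq> ?S" by (rule keys_add)
  then show ?thesis
    using laurent_monomial_superset[of ?S "a + b"] laurent_monomial_superset[of ?S a]
      laurent_monomial_superset[of ?S b]
    by (simp add: lookup_add gen_nonzero power_int_add prod.distrib)
qed

lemma laurent_monomial_nonzero: "laurent_monomial a \<noteq> 0"
  by (simp add: laurent_monomial_def gen_nonzero)

definition laurent_weight :: "(nat \<Rightarrow> int) \<Rightarrow> (nat \<Rightarrow>\<^sub>0 int) \<Rightarrow> int" where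
  "laurent_weight w a = (\<Sum>i\<in>Poly_Mapping.keys a. Poly_Mapping.lookup a i * w i)"

lemma val_laurent_monomial: "val w (laurent_monomial a) = laurent_weight w a"
  by (simp add: laurent_monomial_def laurent_weight_def val_prod gen_nonzero val_powi val_gen)

lemma laurent_weight_superset:
  assumes "finite S" "Poly_Mapping.keys a \<subseteq> S"
  shows "laurent_weight w a = (\<Sum>i\<in>S. Poly_Mapping.lookup a i * w i)"
  unfolding laurent_weight_def using assms
  by (intro sum.mono_neutral_left) (auto simp: in_keys_iff)

lemma laurent_weight_add: "laurent_weight w (a + b) = laurent_weight w a + laurent_weight w b"
  unfolding val_laurent_monomial[symmetric]
  by (simp add: laurent_monomial_add val_mult laurent_monomial_nonzero)

text \<open>Multiplication by the Laurent monomial with exponent vector \<open>s\<close>, done on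
  the formal side. It serves to clear negative exponents and to divide by monomials.\<close>

definition shift :: "(nat \<Rightarrow>\<^sub>0 int) \<Rightarrow> ((nat \<Rightarrow>\<^sub>0 int) \<Rightarrow>\<^sub>0 int) \<Rightarrow> ((nat \<Rightarrow>\<^sub>0 int) \<Rightarrow>\<^sub>0 int)" where
  "shift s p = Poly_Mapping.map_key (\<lambda>a. a - s) p"

lemma lookup_shift: "Poly_Mapping.lookup (shift s p) a = Poly_Mapping.lookup p (a - s)"
  by (simp add: shift_def map_key.rep_eq inj_def)

lemma keys_shift: "Poly_Mapping.keys (shift s p) = (\<lambda>a. a + s) ` Poly_Mapping.keys p"
proof -
  have "Poly_Mapping.keys (shift s p) = {a. a - s \<in> Poly_Mapping.keys p}"
    by (simp add: in_keys_iff set_eq_iff lookup_shift)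
  also have "\<dots> = (\<lambda>a. a + s) ` Poly_Mapping.keys p"
    by (force simp: image_iff)
  finally show ?thesis .
qed

lemma laurent_eval_shift: "laurent_eval (shift s p) = laurent_monomial s * laurent_eval p"
proof -
  have "laurent_eval (shift s p) =
      (\<Sum>a\<in>Poly_Mapping.keys (shift s p). of_int (Poly_Mapping.lookup (shift s p) a) * laurent_monomial a)"
    by (simp add: laurent_eval_def laurent_monomial_def)
  also have "\<dots> = (\<Sum>a\<in>Poly_Mapping.keys p. of_int (Poly_Mapping.lookup p a) * laurent_monomial (a + s))"
    by (simp add: keys_shift sum.reindex lookup_shift)
  also have "\<dots> = laurent_monomial s * laurent_eval p"
    by (simp add: laurent_eval_def laurent_monomial_def[symmetric] laurent_monomial_add
        sum_distrib_left mult_ac)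
  finally show ?thesis .
qed

definition of_mpoly :: "mpoly \<Rightarrow> ratfun" where
  "of_mpoly N = Fract N 1"

lemma of_mpoly_simps:
  "of_mpoly 0 = 0" "of_mpoly 1 = 1" "of_mpoly (N + M) = of_mpoly N + of_mpoly M"
  "of_mpoly (N * M) = of_mpoly N * of_mpoly M"
  by (simp_all add: of_mpoly_def Zero_fract_def One_fract_def)

lemma of_mpoly_sum: "of_mpoly (\<Sum>a\<in>A. N a) = (\<Sum>a\<in>A. of_mpoly (N a))"
  by (induction A rule: infinite_finite_induct) (simp_all add: of_mpoly_simps)

lemma of_mpoly_of_int: "of_mpoly (of_int c) = of_int c"
proof -
  have *: "of_mpoly (of_nat m) = of_nat m" for m
    by (induction m) (simp_all add: of_mpoly_simps)
  have "of_mpoly (- N) = - of_mpoly N" for N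
    using of_mpoly_simps(3)[of N "- N"] by (simp add: of_mpoly_simps add_eq_0_iff)
  then show ?thesis by (cases c rule: int_cases2) (simp_all add: *)
qed

lemma of_mpoly_single_power:
  "of_mpoly (Poly_Mapping.single (Poly_Mapping.single i m) 1) = gen i ^ m"
proof (induction m)
  case 0 then show ?case by (simp add: of_mpoly_simps)
next
  case (Suc m)
  have "Poly_Mapping.single (Poly_Mapping.single i (Suc m)) (1::int)
      = Poly_Mapping.single (Poly_Mapping.single i 1) 1 * Poly_Mapping.single (Poly_Mapping.single i m) 1"
    by (simp add: mult_single single_add[symmetric])
  then show ?case using Suc by (simp add: of_mpoly_simps) (simp add: of_mpoly_def gen_def)
qed

lemma of_mpoly_monomial:
  "finite S \<Longrightarrow> of_mpoly (Poly_Mapping.single (\<Sum>i\<in>S. Poly_Mapping.single i (f i)) 1) = (\<Prod>i\<in>S. gen i ^ f i)"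
proof (induction S rule: finite_induct)
  case empty then show ?case by (simp add: of_mpoly_simps)
next
  case (insert i S)
  have "Poly_Mapping.single (\<Sum>i\<in>insert i S. Poly_Mapping.single i (f i)) (1::int) =
     Poly_Mapping.single (Poly_Mapping.single i (f i)) 1 * Poly_Mapping.single (\<Sum>i\<in>S. Poly_Mapping.single i (f i)) 1"
    using insert.hyps by (simp add: mult_single)
  then show ?case using insert by (simp add: of_mpoly_simps of_mpoly_single_power)
qed

definition nat_exponent :: "(nat \<Rightarrow>\<^sub>0 int) \<Rightarrow> (nat \<Rightarrow>\<^sub>0 nat)" where
  "nat_exponent a = (\<Sum>i\<in>Poly_Mapping.keys a. Poly_Mapping.single i (nat (Poly_Mapping.lookup a i)))"

lemma lookup_nat_exponent:
  "Poly_Mapping.lookup (nat_exponent a) i = nat (Poly_Mapping.lookup a i)"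
  by (auto simp: nat_exponent_def lookup_sum lookup_single when_def in_keys_iff)

lemma laurent_monomial_nat_exponent:
  assumes "\<And>i. 0 \<le> Poly_Mapping.lookup a i"
  shows "laurent_monomial a = of_mpoly (Poly_Mapping.single (nat_exponent a) 1)"
  unfolding nat_exponent_def laurent_monomial_def
  by (subst of_mpoly_monomial) (use assms in \<open>auto simp: power_int_def\<close>)

lemma weight_nat_exponent:
  assumes "\<And>i. 0 \<le> Poly_Mapping.lookup a i"
  shows "weight w (nat_exponent a) = laurent_weight w a"
  using weight_superset[of "Poly_Mapping.keys a" "nat_exponent a" w] assms
  by (simp add: laurent_weight_def lookup_nat_exponent)
    (metis (no_types, lifting) finite_keys in_keys_iff lookup_nat_exponent nat_0 subsetI)

lemma inj_on_nat_exponent: "inj_on nat_exponent {a. \<forall>i. 0 \<le> Poly_Mapping.lookup a i}"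
proof (rule inj_onI, rule poly_mapping_eqI)
  fix a b i assume *: "a \<in> {a. \<forall>i. 0 \<le> Poly_Mapping.lookup a i}"
    "b \<in> {a. \<forall>i. 0 \<le> Poly_Mapping.lookup a i}" "nat_exponent a = nat_exponent b"
  then have "nat (Poly_Mapping.lookup a i) = nat (Poly_Mapping.lookup b i)"
    by (metis lookup_nat_exponent)
  then show "Poly_Mapping.lookup a i = Poly_Mapping.lookup b i" using * by (simp add: eq_nat_nat_iff)
qed

text \<open>Without negative exponents, \<open>laurent_eval p\<close> is the image of an ordinary
  polynomial \<open>N\<close>, whose support corresponds to that of \<open>p\<close> under the
  injective map \<open>nat_exponent\<close>.\<close>

lemma val_laurent_eval_nonneg:
  assumes "p \<noteq> 0" "\<And>a i. a \<in> Poly_Mapping.keys p \<Longrightarrow> 0 \<le> Poly_Mapping.lookup a i"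
  shows "laurent_eval p \<noteq> 0" "val w (laurent_eval p) = Min (laurent_weight w ` Poly_Mapping.keys p)"
proof -
  define N where "N = (\<Sum>a\<in>Poly_Mapping.keys p. Poly_Mapping.single (nat_exponent a) (Poly_Mapping.lookup p a))"
  have inj: "inj_on nat_exponent (Poly_Mapping.keys p)"
    by (rule inj_on_subset[OF inj_on_nat_exponent]) (use assms(2) in auto)
  have "of_mpoly (Poly_Mapping.single (nat_exponent a) c) = of_int c * laurent_monomial a"
    if "a \<in> Poly_Mapping.keys p" for a c
  proof -
    have "Poly_Mapping.single (nat_exponent a) c = of_int c * Poly_Mapping.single (nat_exponent a) 1"
      unfolding single_of_int[symmetric] by (simp add: mult_single)
    then show ?thesis
      using assms(2)[OF that] by (simp add: of_mpoly_simps of_mpoly_of_int laurent_monomial_nat_exponent)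
  qed
  then have ev: "laurent_eval p = of_mpoly N"
    by (simp add: N_def of_mpoly_sum laurent_eval_def laurent_monomial_def[symmetric])
  have look: "Poly_Mapping.lookup N (nat_exponent a) = Poly_Mapping.lookup p a"
    if "a \<in> Poly_Mapping.keys p" for a
  proof -
    have "Poly_Mapping.lookup N (nat_exponent a) =
        (\<Sum>b\<in>Poly_Mapping.keys p. if b = a then Poly_Mapping.lookup p b else 0)"
      unfolding N_def lookup_sum
      by (rule sum.cong) (use inj that in \<open>auto simp: lookup_single when_def inj_on_def\<close>)
    then show ?thesis using that by simp
  qed
  have keys: "Poly_Mapping.keys N = nat_exponent ` Poly_Mapping.keys p"
  proof
    show "Poly_Mapping.keys N \<subseteq> nat_exponent ` Poly_Mapping.keys p"
      unfolding N_def by (rule order_trans[OF keys_sum]) (auto split: if_splits)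
    show "nat_exponent ` Poly_Mapping.keys p \<subseteq> Poly_Mapping.keys N"
      using look by (auto simp: in_keys_iff)
  qed
  then have N: "N \<noteq> 0"
    using assms(1) by (metis image_is_empty keys_zero keys_eq_empty)
  then show "laurent_eval p \<noteq> 0"
    unfolding ev by (simp add: of_mpoly_def Zero_fract_def eq_fract)
  have "val w (laurent_eval p) = min_weight w N"
    unfolding ev of_mpoly_def using N by (simp add: val_Fract min_weight_one)
  also have "\<dots> = Min (laurent_weight w ` Poly_Mapping.keys p)"
    unfolding min_weight_def keys image_image
    by (intro arg_cong[of _ _ Min] image_cong) (use assms(2) in \<open>auto simp: weight_nat_exponent\<close>)
  finally show "val w (laurent_eval p) = Min (laurent_weight w ` Poly_Mapping.keys p)" .
qed

lemma val_laurent_eval: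
  assumes "p \<noteq> 0"
  shows "laurent_eval p \<noteq> 0" "val w (laurent_eval p) = Min (laurent_weight w ` Poly_Mapping.keys p)"
proof -
  \<comment> \<open>Each exponent of \<open>s\<close> bounds the absolute values of the
    corresponding exponents in \<open>p\<close>, so multiplying by this monomial leads to the
    nonnegative case.\<close>
  define s where "s = (\<Sum>a\<in>Poly_Mapping.keys p. \<Sum>i\<in>Poly_Mapping.keys a.
    Poly_Mapping.single i \<bar>Poly_Mapping.lookup a i\<bar>)"
  have s: "Poly_Mapping.lookup s i = (\<Sum>a\<in>Poly_Mapping.keys p. \<bar>Poly_Mapping.lookup a i\<bar>)" for i
    unfolding s_def lookup_sum by (rule sum.cong) (auto simp: lookup_single when_def in_keys_iff)
  have nn: "0 \<le> Poly_Mapping.lookup (a + s) i" if "a \<in> Poly_Mapping.keys p" for a i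
    using member_le_sum[OF that, of "\<lambda>a. \<bar>Poly_Mapping.lookup a i\<bar>"] by (simp add: lookup_add s)
  have ne: "Poly_Mapping.keys p \<noteq> {}" using assms by simp
  have "shift s p \<noteq> 0"
    using ne keys_shift[of s p] by (metis image_is_empty keys_zero)
  note * = val_laurent_eval_nonneg[OF this]
  have 1: "laurent_eval (shift s p) \<noteq> 0"
    by (rule *(1)) (use nn in \<open>auto simp: keys_shift\<close>)
  then show nz: "laurent_eval p \<noteq> 0" by (auto simp: laurent_eval_shift)
  have "val w (laurent_eval (shift s p)) = Min (laurent_weight w ` Poly_Mapping.keys (shift s p))"
    by (rule *(2)) (use nn in \<open>auto simp: keys_shift\<close>)
  also have "laurent_weight w ` Poly_Mapping.keys (shift s p) =
      (\<lambda>a. laurent_weight w a + laurent_weight w s) ` Poly_Mapping.keys p"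
    by (simp add: keys_shift image_image laurent_weight_add)
  also have "Min \<dots> = Min (laurent_weight w ` Poly_Mapping.keys p) + laurent_weight w s"
    by (rule Min_add_commute) (use ne in auto)
  finally show "val w (laurent_eval p) = Min (laurent_weight w ` Poly_Mapping.keys p)"
    using nz by (simp add: laurent_eval_shift val_mult laurent_monomial_nonzero val_laurent_monomial)
qed

lemma laurent_monomial_zero: "laurent_monomial 0 = 1"
  by (simp add: laurent_monomial_def)

lemma laurent_monomial_uminus: "laurent_monomial (- a) = inverse (laurent_monomial a)"
  using laurent_monomial_add[of "- a" a] laurent_monomial_nonzero[of a]
  by (simp add: laurent_monomial_zero field_simps)

lemma laurent_monomial_single: "laurent_monomial (Poly_Mapping.single i m) = gen i powi m"
  by (simp add: laurent_monomial_def)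

section \<open>Degrees and denominator vectors as valuations\<close>

definition degree_weight :: "nat \<Rightarrow> imat \<Rightarrow> nat \<Rightarrow> nat \<Rightarrow> int" where
  "degree_weight n B0 j l = of_bool (l = j) - (\<Sum>i=1..n. of_bool (l = n + i) * B0 j i)"

lemma monomial_degree_eq_laurent_weight:
  "monomial_degree n B0 a j = laurent_weight (degree_weight n B0 j) a"
proof -
  define S where "S = insert j (Poly_Mapping.keys a \<union> {n+1..n+n})"
  have S: "finite S" "Poly_Mapping.keys a \<subseteq> S" "j \<in> S" "\<And>i. i \<in> {1..n} \<Longrightarrow> n + i \<in> S"
    by (auto simp: S_def)
  have 1: "(\<Sum>l\<in>S. Poly_Mapping.lookup a l * of_bool (l = m)) = Poly_Mapping.lookup a m" if "m \<in> S" for m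
    using sum.delta[of S m "Poly_Mapping.lookup a"] S(1) that
    by (simp add: of_bool_def if_distrib[of "\<lambda>x. _ * x"] cong: if_cong)
  have "(\<Sum>l\<in>S. Poly_Mapping.lookup a l * (\<Sum>i=1..n. of_bool (l = n + i) * B0 j i)) =
      (\<Sum>l\<in>S. \<Sum>i=1..n. Poly_Mapping.lookup a l * of_bool (l = n + i) * B0 j i)"
    by (simp only: sum_distrib_left mult.assoc)
  also have "\<dots> = (\<Sum>i=1..n. \<Sum>l\<in>S. Poly_Mapping.lookup a l * of_bool (l = n + i) * B0 j i)"
    by (rule sum.swap)
  also have "\<dots> = (\<Sum>i=1..n. Poly_Mapping.lookup a (n + i) * B0 j i)"
    by (rule sum.cong) (simp_all add: sum_distrib_right[symmetric] 1 S(4))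
  finally show ?thesis
    using 1[OF S(3)]
    by (simp add: monomial_degree_def laurent_weight_superset[OF S(1,2)] degree_weight_def
        right_diff_distrib sum_subtractf)
qed

text \<open>Since the numerator has a term free of \<open>x_i\<close>, the lowest exponent of
  \<open>x_i\<close> in \<open>z\<close> is \<open>- d i\<close>, and this is the valuation with
  weight 1 on \<open>x_i\<close> and 0 elsewhere.\<close>

lemma has_denominator_vectorE:
  assumes "has_denominator_vector n z d" "1 \<le> n"
  obtains p where "p \<noteq> 0" "z = laurent_eval p" "\<And>a. a \<in> Poly_Mapping.keys p \<Longrightarrow> Poly_Mapping.keys a \<subseteq> {1..2*n}"
    "\<And>i. i \<in> {1..n} \<Longrightarrow> val (\<lambda>l. of_bool (l = i)) z = - d i"
proof -
  obtain N where N: "N \<in> x_polynomials n" "z = N / (\<Prod>i=1..n. gen i powi d i)"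
    "\<And>i. i \<in> {1..n} \<Longrightarrow> \<not> (\<exists>M\<in>x_polynomials n. N = gen i * M)"
    using assms(1) unfolding has_denominator_vector_def by blast
  obtain p where p: "N = laurent_eval p"
    "\<And>a. a \<in> Poly_Mapping.keys p \<Longrightarrow> Poly_Mapping.keys a \<subseteq> {1..2*n}"
    "\<And>a i. a \<in> Poly_Mapping.keys p \<Longrightarrow> i \<in> {1..n} \<Longrightarrow> 0 \<le> Poly_Mapping.lookup a i"
    using N(1) unfolding x_polynomials_def laurent_span_def by blast
  have e0: "laurent_eval 0 = 0" by (simp add: laurent_eval_def)
  then have "0 \<in> x_polynomials n"
    unfolding x_polynomials_def laurent_span_def by (force intro!: exI[of _ 0])
  \<comment> \<open>A numerator 0 would be divisible by \<open>x_1\<close>; this is where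
    \<open>n\<close> has to be positive.\<close>
  then have p0: "p \<noteq> 0" using N(3)[of 1] p(1) e0 assms(2) by force
  \<comment> \<open>If \<open>x_i\<close> occurred in all terms, lowering its exponent by one
    throughout would exhibit the numerator as \<open>x_i\<close> times an element of
    \<open>x_polynomials n\<close>.\<close>
  have ex: "\<exists>a\<in>Poly_Mapping.keys p. Poly_Mapping.lookup a i = 0" if i: "i \<in> {1..n}" for i
  proof (rule ccontr)
    assume no: "\<not> ?thesis"
    let ?s = "Poly_Mapping.single i (1::int)"
    have "laurent_eval (shift (- ?s) p) \<in> x_polynomials n"
      unfolding x_polynomials_def laurent_span_def
    proof (rule CollectI, rule exI[of _ "shift (- ?s) p"], rule conjI[OF refl], rule subsetI, rule CollectI, rule conjI)
      fix b assume "b \<in> Poly_Mapping.keys (shift (- ?s) p)"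
      then obtain a where a: "a \<in> Poly_Mapping.keys p" "b = a - ?s" by (auto simp: keys_shift)
      have "Poly_Mapping.keys b \<subseteq> insert i (Poly_Mapping.keys a)"
        by (auto simp: a(2) in_keys_iff lookup_minus lookup_single when_def split: if_splits)
      then show "Poly_Mapping.keys b \<subseteq> {1..2*n}" using p(2)[OF a(1)] i by fastforce
      have "Poly_Mapping.lookup a i \<noteq> 0" using no a(1) by blast
      then show "\<forall>l\<in>{1..n}. 0 \<le> Poly_Mapping.lookup b l"
        using p(3)[OF a(1)] by (force simp: a(2) lookup_minus lookup_single when_def)
    qed
    moreover have "N = gen i * laurent_eval (shift (- ?s) p)"
      by (simp add: laurent_eval_shift laurent_monomial_uminus laurent_monomial_single gen_nonzero p(1))
    ultimately show False using N(3)[OF i] by blast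
  qed
  have N0: "N \<noteq> 0" using val_laurent_eval(1)[OF p0] p(1) by simp
  define D where "D = (\<Sum>i=1..n. Poly_Mapping.single i (d i))"
  have D: "Poly_Mapping.lookup D l = (if l \<in> {1..n} then d l else 0)" for l
    by (simp add: D_def lookup_sum lookup_single when_def)
  have kD: "Poly_Mapping.keys D \<subseteq> {1..n}" by (auto simp: in_keys_iff D split: if_splits)
  have mD: "laurent_monomial D = (\<Prod>i=1..n. gen i powi d i)"
    by (subst laurent_monomial_superset[OF _ kD]) (auto simp: D)
  show thesis
  proof (rule that)
    show "shift (- D) p \<noteq> 0"
      using p0 keys_shift[of "- D" p] by (metis image_is_empty keys_zero keys_nonempty keys_eq_empty)
    show "z = laurent_eval (shift (- D) p)"
      by (simp add: N(2) p(1) laurent_eval_shift laurent_monomial_uminus mD divide_inverse)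
    fix b assume "b \<in> Poly_Mapping.keys (shift (- D) p)"
    then obtain a where a: "a \<in> Poly_Mapping.keys p" "b = a - D" by (auto simp: keys_shift)
    have "Poly_Mapping.keys b \<subseteq> Poly_Mapping.keys D \<union> Poly_Mapping.keys a"
      by (auto simp: a(2) in_keys_iff lookup_minus)
    then show "Poly_Mapping.keys b \<subseteq> {1..2*n}" using p(2)[OF a(1)] kD by fastforce
  next
    fix i assume i: "i \<in> {1..n}"
    let ?w = "\<lambda>l. of_bool (l = i)"
    have lw: "laurent_weight ?w a = Poly_Mapping.lookup a i" for a
    proof -
      have "laurent_weight ?w a = (\<Sum>l\<in>insert i (Poly_Mapping.keys a). Poly_Mapping.lookup a l * ?w l)"
        by (rule laurent_weight_superset) auto
      also have "\<dots> = (\<Sum>l\<in>insert i (Poly_Mapping.keys a). if l = i then Poly_Mapping.lookup a l else 0)"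
        by (rule sum.cong) auto
      finally show ?thesis by simp
    qed
    obtain a where a: "a \<in> Poly_Mapping.keys p" "Poly_Mapping.lookup a i = 0" using ex[OF i] by blast
    have "Min (laurent_weight ?w ` Poly_Mapping.keys p) = 0"
    proof (rule Min_eqI)
      show "0 \<in> laurent_weight ?w ` Poly_Mapping.keys p"
        using a lw[of a] by (metis imageI)
    qed (use p(3) i in \<open>auto simp: lw\<close>)
    then have "val ?w N = 0" using val_laurent_eval(2)[OF p0, of ?w] p(1) by simp
    moreover have "z = laurent_monomial (- D) * N"
      by (simp add: N(2) laurent_monomial_uminus mD divide_inverse)
    moreover have "laurent_weight ?w (- D) = - d i" using i by (simp add: lw D)
    ultimately show "val ?w z = - d i"
      using N0 by (simp add: val_mult laurent_monomial_nonzero val_laurent_monomial)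
  qed
qed

text \<open>A Laurent polynomial is homogeneous if its minimal and its maximal degree agree.\<close>

lemma has_g_vectorI:
  assumes "has_denominator_vector n z d" "1 \<le> n"
    and "\<And>j. j \<in> {1..n} \<Longrightarrow> val (degree_weight n B0 j) z = g j"
    and "\<And>j. j \<in> {1..n} \<Longrightarrow> val (\<lambda>l. - degree_weight n B0 j l) z = - g j"
  shows "has_g_vector n B0 z g"
proof -
  obtain p where p: "p \<noteq> 0" "z = laurent_eval p"
    "\<And>a. a \<in> Poly_Mapping.keys p \<Longrightarrow> Poly_Mapping.keys a \<subseteq> {1..2*n}"
    using has_denominator_vectorE[OF assms(1,2)] by metis
  have "monomial_degree n B0 a j = g j" if "a \<in> Poly_Mapping.keys p" "j \<in> {1..n}" for a j
  proof -
    have "Min (laurent_weight w ` Poly_Mapping.keys p) \<le> laurent_weight w a" for w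
      using that by simp
    then have "val w z \<le> laurent_weight w a" for w
      using val_laurent_eval(2)[OF p(1)] p(2) by simp
    from this[of "degree_weight n B0 j"] this[of "\<lambda>l. - degree_weight n B0 j l"]
    show ?thesis using assms(3,4)[OF that(2)]
      by (simp add: monomial_degree_eq_laurent_weight laurent_weight_def sum_negf)
  qed
  then have "Poly_Mapping.keys p \<subseteq> {a. Poly_Mapping.keys a \<subseteq> {1..2*n} \<and>
      (\<forall>j\<in>{1..n}. monomial_degree n B0 a j = g j)}"
    using p(3) by blast
  then show ?thesis
    unfolding has_g_vector_def laurent_span_def
    using p(2) val_laurent_eval(1)[OF p(1)] by auto
qed

section \<open>Triangulations of a polygon\<close>

declare [[smt_nat_as_int]]

text \<open>
  Vertices of the \<open>(n+3)\<close>-gon are the numbers \<open>0, \<dots>, n + 2\<close> in cyclic order.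
\<close>

definition cyc :: "nat \<Rightarrow> nat \<Rightarrow> nat \<Rightarrow> bool" where
  "cyc a b c \<longleftrightarrow> a < b \<and> b < c \<or> b < c \<and> c < a \<or> c < a \<and> a < b"

text \<open>The vertices \<open>a\<close>, \<open>b\<close>, \<open>c\<close>, \<open>d\<close>
  follow each other in the cyclic order. Facts about few vertices become finite case distinctions on
  their linear order, which the SMT solver settles as integer arithmetic.\<close>

definition quad :: "nat \<Rightarrow> nat \<Rightarrow> nat \<Rightarrow> nat \<Rightarrow> bool" where
  "quad a b c d \<longleftrightarrow> cyc a b c \<and> cyc c d a"

definition crosses :: "nat \<Rightarrow> nat \<Rightarrow> nat \<Rightarrow> nat \<Rightarrow> bool" where
  "crosses u v p q \<longleftrightarrow> cyc u p v \<and> cyc v q u \<or> cyc u q v \<and> cyc v p u"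

definition boundary :: "nat \<Rightarrow> nat \<Rightarrow> nat \<Rightarrow> bool" where
  "boundary n u v \<longleftrightarrow> v = Suc u \<or> u = Suc v \<or> {u, v} = {0, n + 2}"

lemma quad_rotate: "quad a b c d \<Longrightarrow> quad b c d a"
  unfolding quad_def cyc_def by (smt (verit))

lemma quad_distinct: "quad a b c d \<Longrightarrow> distinct [a, b, c, d]"
  unfolding quad_def cyc_def by auto

text \<open>When \<open>ac\<close> is flipped to \<open>bd\<close>, the triangle \<open>abc\<close>
  on the side \<open>ab\<close> gives way to \<open>abd\<close>, so \<open>d\<close> takes the place
  of \<open>c\<close> in the quadrilateral around \<open>ab\<close>. The next lemma is the analogue
  for the side \<open>bc\<close>, where \<open>d\<close> takes the place of
  \<open>a\<close>.\<close>

lemma quad_flip_ab: "quad a b c d \<Longrightarrow> quad a e b c \<Longrightarrow> quad a e b d"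
  unfolding quad_def cyc_def by (smt (verit))

lemma quad_flip_bc: "quad a b c d \<Longrightarrow> quad b e c a \<Longrightarrow> quad b e c d"
  unfolding quad_def cyc_def by (smt (verit))

lemma quad_crosses: "quad a b c d \<Longrightarrow> crosses a c b d"
  unfolding quad_def crosses_def cyc_def by (smt (verit))

lemma crosses_sym: "crosses u v p q \<longleftrightarrow> crosses p q u v"
  "crosses u v p q \<longleftrightarrow> crosses v u p q" "crosses u v p q \<longleftrightarrow> crosses u v q p"
  unfolding crosses_def cyc_def by (smt (verit))+

lemma crosses_self: "\<not> crosses u v u q" "\<not> crosses u v v q"
  unfolding crosses_def cyc_def by (smt (verit))+

lemma boundary_not_crosses:
  assumes "boundary n u v" "p \<le> n + 2" "q \<le> n + 2"
  shows "\<not> crosses u v p q"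
proof -
  have "v = Suc u \<or> u = Suc v \<or> u = 0 \<and> v = n + 2 \<or> v = 0 \<and> u = n + 2"
    using assms(1) by (auto simp: boundary_def doubleton_eq_iff)
  then show ?thesis using assms(2,3) unfolding crosses_def cyc_def by (smt (verit))
qed

text \<open>A chord that meets the interior of the quadrilateral and leaves through no side must end
  at vertices on both sides of \<open>bd\<close>. Hence the new diagonal of a flip crosses no old
  one except \<open>ac\<close>.\<close>

lemma crosses_diagonal:
  assumes "quad a b c d" "crosses b d p q" "\<not> crosses a b p q" "\<not> crosses b c p q"
    "\<not> crosses c d p q" "\<not> crosses d a p q"
  shows "{p, q} = {a, c}"
proof -
  have "p = a \<and> q = c \<or> p = c \<and> q = a"
    using assms unfolding quad_def crosses_def cyc_def by (smt (verit))
  then show ?thesis by auto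
qed

section \<open>Labelled triangulations and their extended exchange matrices\<close>

definition edge :: "nat \<Rightarrow> (nat \<Rightarrow> nat set) \<Rightarrow> nat \<Rightarrow> nat \<Rightarrow> bool" where
  "edge n E u v \<longleftrightarrow> boundary n u v \<or> (\<exists>i\<in>{1..n}. E i = {u, v})"

text \<open>
  The diagonal \<open>k\<close> is surrounded by the quadrilateral \<open>abcd\<close>, from which the \<open>k\<close>-th column of the
  exchange matrix is read off. A row \<open>r \<in> M\<close> is the shear coordinate of the lamination whose
  intersection numbers with the edges are given by \<open>f r\<close>; twice the row keeps it integral. Taking
  \<open>M = {}\<close> gives plain exchange matrices.
\<close>

definition quad_at ::
  "nat \<Rightarrow> nat set \<Rightarrow> (nat \<Rightarrow> nat \<Rightarrow> nat \<Rightarrow> int) \<Rightarrow> (nat \<Rightarrow> nat set) \<Rightarrow> imat \<Rightarrow>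
    nat \<Rightarrow> nat \<Rightarrow> nat \<Rightarrow> nat \<Rightarrow> nat \<Rightarrow> bool" where
  "quad_at n M f E B k a b c d \<longleftrightarrow>
     quad a b c d \<and> {a, b, c, d} \<subseteq> {..n + 2} \<and> E k = {a, c} \<and>
     edge n E a b \<and> edge n E b c \<and> edge n E c d \<and> edge n E d a \<and>
     (\<forall>i\<in>{1..n}. B i k = of_bool (E i = {a, b}) + of_bool (E i = {c, d})
        - of_bool (E i = {b, c}) - of_bool (E i = {d, a})) \<and>
     (\<forall>r\<in>M. 2 * B r k = f r b c + f r d a - f r a b - f r c d)"

definition triangulation ::
  "nat \<Rightarrow> nat set \<Rightarrow> (nat \<Rightarrow> nat \<Rightarrow> nat \<Rightarrow> int) \<Rightarrow> (nat \<Rightarrow> nat set) \<Rightarrow> imat \<Rightarrow> bool" where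
  "triangulation n M f E B \<longleftrightarrow>
     inj_on E {1..n} \<and>
     (\<forall>i\<in>{1..n}. \<forall>j\<in>{1..n}. B i j = - B j i) \<and>
     (\<forall>k\<in>{1..n}. \<exists>a b c d. quad_at n M f E B k a b c d) \<and>
     (\<forall>i\<in>{1..n}. \<forall>j\<in>{1..n}. \<forall>u v p q. E i = {u, v} \<longrightarrow> E j = {p, q} \<longrightarrow> \<not> crosses u v p q)"

text \<open>The Ptolemy relation in max-plus form. It makes shear coordinates mutate like rows of an
  extended exchange matrix, and it holds for \<open>lamination\<close> as well as for
  \<open>crossing\<close>.\<close>

definition tropical :: "(nat \<Rightarrow> nat \<Rightarrow> int) \<Rightarrow> bool" where
  "tropical f \<longleftrightarrow> (\<forall>p q. f p q = f q p) \<and>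
     (\<forall>a b c d. quad a b c d \<longrightarrow> f a c + f b d = max (f a b + f c d) (f b c + f d a))"

lemma boundary_commute: "boundary n u v \<longleftrightarrow> boundary n v u"
  unfolding boundary_def by (metis insert_commute)

lemma edge_commute: "edge n E u v \<longleftrightarrow> edge n E v u"
  unfolding edge_def by (metis insert_commute boundary_commute)

lemma quad_atD:
  assumes "quad_at n M f E B k a b c d"
  shows "quad a b c d" "E k = {a, c}" "a \<le> n + 2" "b \<le> n + 2" "c \<le> n + 2" "d \<le> n + 2"
    "edge n E a b" "edge n E b c" "edge n E c d" "edge n E d a" "distinct [a, b, c, d]"
  using assms quad_distinct[of a b c d] unfolding quad_at_def by auto

lemma sides_sign:
  assumes "distinct [a, b, c, d]"
  shows "of_bool (x = {a, b}) + of_bool (x = {c, d}) - of_bool (x = {b, c}) - of_bool (x = {d, a})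
    = (if x = {a, b} \<or> x = {c, d} then 1 else if x = {b, c} \<or> x = {d, a} then -1 else (0::int))"
proof -
  have "{a, b} \<noteq> {c, d}" "{a, b} \<noteq> {b, c}" "{a, b} \<noteq> {d, a}" "{c, d} \<noteq> {b, c}" "{c, d} \<noteq> {d, a}" "{b, c} \<noteq> {d, a}"
    using assms by (auto simp: doubleton_eq_iff)
  then show ?thesis by (auto simp: of_bool_def)
qed

text \<open>The four sides are different sets, so at most one of the indicators is 1. The first two
  parts give the exponents of an exchange relation, the last two the correction term of matrix
  mutation for \<open>B k j = 1\<close> and \<open>B k j = -1\<close>.\<close>

lemma sides_sign_parts:
  assumes "distinct [a, b, c, d]"
    and "s = of_bool (x = {a, b}) + of_bool (x = {c, d}) - of_bool (x = {b, c}) - of_bool (x = {d, a})"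
  shows "max s 0 = of_bool (x = {a, b}) + of_bool (x = {c, d})"
    and "max (- s) 0 = of_bool (x = {b, c}) + of_bool (x = {d, a})"
    and "sgn s * max s 0 = of_bool (x = {a, b}) + of_bool (x = {c, d})"
    and "sgn s * max (- s) 0 = - of_bool (x = {b, c}) - (of_bool (x = {d, a}) :: int)"
proof -
  have "{a, b} \<noteq> {c, d}" "{a, b} \<noteq> {b, c}" "{a, b} \<noteq> {d, a}" "{c, d} \<noteq> {b, c}" "{c, d} \<noteq> {d, a}" "{b, c} \<noteq> {d, a}"
    using assms(1) by (auto simp: doubleton_eq_iff)
  then show "max s 0 = of_bool (x = {a, b}) + of_bool (x = {c, d})"
    "max (- s) 0 = of_bool (x = {b, c}) + of_bool (x = {d, a})"
    "sgn s * max s 0 = of_bool (x = {a, b}) + of_bool (x = {c, d})"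
    "sgn s * max (- s) 0 = - of_bool (x = {b, c}) - of_bool (x = {d, a})"
    unfolding assms(2) by (auto simp: of_bool_def)
qed

lemma quad_at_rotate:
  assumes "quad_at n M f E B k a b c d"
  shows "quad_at n M f E B k c d a b"
proof -
  have "quad c d a b" using assms quad_rotate[OF quad_rotate] by (simp add: quad_at_def)
  moreover have "B i k = of_bool (E i = {c, d}) + of_bool (E i = {a, b})
        - of_bool (E i = {d, a}) - of_bool (E i = {b, c})" if "i \<in> {1..n}" for i
    using assms that by (simp add: quad_at_def)
  moreover have "2 * B r k = f r d a + f r b c - f r c d - f r a b" if "r \<in> M" for r
    using assms that by (simp add: quad_at_def)
  ultimately show ?thesis using assms by (simp add: quad_at_def insert_commute)
qed

lemma quad_at_diagonal:
  assumes "quad_at n M f E B k p q r s" "E k = {a, c}"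
  obtains b d where "quad_at n M f E B k a b c d"
proof -
  have "{p, r} = {a, c}" using quad_atD(2)[OF assms(1)] assms(2) by simp
  then show thesis using assms(1) quad_at_rotate[OF assms(1)] that
    unfolding doubleton_eq_iff by blast
qed

context
  fixes n M f E B
  assumes tri: "triangulation n M f E B"
begin

lemma triangulation_quad:
  assumes "k \<in> {1..n}"
  obtains a b c d where "quad_at n M f E B k a b c d"
  using tri assms unfolding triangulation_def by metis

lemma triangulation_skew: "i \<in> {1..n} \<Longrightarrow> j \<in> {1..n} \<Longrightarrow> B i j = - B j i"
  using tri unfolding triangulation_def by metis

lemma triangulation_inj: "i \<in> {1..n} \<Longrightarrow> j \<in> {1..n} \<Longrightarrow> E i = E j \<Longrightarrow> i = j"
  using tri unfolding triangulation_def inj_on_def by metis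

lemma triangulation_not_crosses:
  "i \<in> {1..n} \<Longrightarrow> j \<in> {1..n} \<Longrightarrow> E i = {u, v} \<Longrightarrow> E j = {p, q} \<Longrightarrow> \<not> crosses u v p q"
  using tri unfolding triangulation_def by metis

lemma diagonal_obtain:
  assumes "k \<in> {1..n}"
  obtains u v where "E k = {u, v}" "u < v" "v \<le> n + 2" "\<not> boundary n u v"
proof -
  obtain a b c d where *: "quad_at n M f E B k a b c d" by (rule triangulation_quad[OF assms])
  note q = quad_atD[OF *]
  have "crosses a c b d" by (rule quad_crosses[OF q(1)])
  then have "\<not> boundary n a c" using boundary_not_crosses q(4,6) by blast
  then show thesis
    using that[of a c] that[of c a] q(2,3,5,11) by (metis boundary_commute distinct_length_2_or_more insert_commute nat_neq_iff)
qed

lemma diagonal_not_boundary: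
  assumes "k \<in> {1..n}" "E k = {u, v}"
  shows "\<not> boundary n u v" "u \<le> n + 2" "v \<le> n + 2" "u \<noteq> v"
proof -
  obtain a c where "E k = {a, c}" "a < c" "c \<le> n + 2" "\<not> boundary n a c"
    by (rule diagonal_obtain[OF assms(1)])
  note ac = this
  then have "u = a \<and> v = c \<or> u = c \<and> v = a" using assms(2) by (metis doubleton_eq_iff)
  then show "\<not> boundary n u v" "u \<le> n + 2" "v \<le> n + 2" "u \<noteq> v"
    using ac(2-4) boundary_commute[of n a c] by (elim disjE; simp)+
qed

lemma edge_not_crosses:
  assumes "edge n E u v" "i \<in> {1..n}" "E i = {p, q}"
  shows "\<not> crosses u v p q"
  using assms boundary_not_crosses diagonal_not_boundary(2,3) triangulation_not_crosses
  unfolding edge_def by metis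

text \<open>
  Skew-symmetry replaces the geometric argument that the triangle \<open>abc\<close> is the only one on its side
  of the edge \<open>ab\<close>.
\<close>

lemma quad_at_side_ab:
  assumes "k \<in> {1..n}" "j \<in> {1..n}" "quad_at n M f E B k a b c d" "E j = {a, b}"
  shows "\<exists>e. quad_at n M f E B j a e b c" "B j k = 1"
proof -
  have k: "distinct [a, b, c, d]" "E k = {a, c}" using quad_atD[OF assms(3)] by blast+
  have "B j k = of_bool (E j = {a, b}) + of_bool (E j = {c, d}) - of_bool (E j = {b, c}) - of_bool (E j = {d, a})"
    using assms(2,3) by (simp add: quad_at_def)
  then show bjk: "B j k = 1" using k assms(4) by (auto simp: doubleton_eq_iff)
  obtain p q r s where "quad_at n M f E B j p q r s" by (rule triangulation_quad[OF assms(2)])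
  note qj = this
  obtain e y where j: "quad_at n M f E B j a e b y"
    using quad_at_diagonal[of n M f E B j p q r s a b, OF qj assms(4)] .
  then have dj: "distinct [a, e, b, y]" by (rule quad_atD(11))
  have "B k j = of_bool (E k = {a, e}) + of_bool (E k = {b, y}) - of_bool (E k = {e, b}) - of_bool (E k = {y, a})"
    using assms(1) j by (simp add: quad_at_def)
  moreover have "B k j = -1" using triangulation_skew[OF assms(1,2)] bjk by simp
  ultimately have "E k = {e, b} \<or> E k = {y, a}" by (simp add: of_bool_def split: if_splits)
  then have "y = c" using k dj by (auto simp: doubleton_eq_iff)
  then show "\<exists>e. quad_at n M f E B j a e b c" using j by blast
qed

lemma quad_at_side_bc:
  assumes "k \<in> {1..n}" "j \<in> {1..n}" "quad_at n M f E B k a b c d" "E j = {b, c}"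
  shows "\<exists>e. quad_at n M f E B j b e c a" "B j k = -1"
proof -
  have k: "distinct [a, b, c, d]" "E k = {a, c}" using quad_atD[OF assms(3)] by blast+
  have "B j k = of_bool (E j = {a, b}) + of_bool (E j = {c, d}) - of_bool (E j = {b, c}) - of_bool (E j = {d, a})"
    using assms(2,3) by (simp add: quad_at_def)
  then show bjk: "B j k = -1" using k assms(4) by (auto simp: doubleton_eq_iff)
  obtain p q r s where "quad_at n M f E B j p q r s" by (rule triangulation_quad[OF assms(2)])
  note qj = this
  obtain e y where j: "quad_at n M f E B j b e c y"
    using quad_at_diagonal[of n M f E B j p q r s b c, OF qj assms(4)] .
  then have dj: "distinct [b, e, c, y]" by (rule quad_atD(11))
  have "B k j = of_bool (E k = {b, e}) + of_bool (E k = {c, y}) - of_bool (E k = {e, c}) - of_bool (E k = {y, b})"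
    using assms(1) j by (simp add: quad_at_def)
  moreover have "B k j = 1" using triangulation_skew[OF assms(1,2)] bjk by simp
  ultimately have "E k = {b, e} \<or> E k = {c, y}" by (simp add: of_bool_def split: if_splits)
  then have "y = a" using k dj by (auto simp: doubleton_eq_iff)
  then show "\<exists>e. quad_at n M f E B j b e c a" using j by blast
qed

section \<open>The flip of the diagonal \<open>k\<close> from \<open>ac\<close> to
  \<open>bd\<close>\<close>

context
  fixes k a b c d E' B'
  assumes k: "k \<in> {1..n}" and qk: "quad_at n M f E B k a b c d"
    and M: "M \<inter> {1..n} = {}" and trop: "\<And>r. r \<in> M \<Longrightarrow> tropical (f r)"
  defines "E' \<equiv> E(k := {b, d})" and "B' \<equiv> mutate_matrix k B"
begin

lemma quad_facts: "quad a b c d" "E k = {a, c}" "distinct [a, b, c, d]" "{a, b, c, d} \<subseteq> {..n + 2}"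
  using quad_atD[OF qk] by auto

lemma E'_simps: "E' k = {b, d}" "i \<noteq> k \<Longrightarrow> E' i = E i"
  by (auto simp: E'_def)

lemma new_diagonal_fresh: "i \<in> {1..n} \<Longrightarrow> E i \<noteq> {b, d}"
  using triangulation_not_crosses[OF k, of i a c b d] quad_facts quad_crosses by blast

lemma edge_flip: "edge n E u v \<Longrightarrow> E k \<noteq> {u, v} \<Longrightarrow> edge n E' u v"
  unfolding edge_def using E'_simps(2) by metis

lemma flip_sides: "edge n E' a b" "edge n E' b c" "edge n E' c d" "edge n E' d a" "edge n E' b d"
proof -
  note quad_atD(7-10)[OF qk]
  then show "edge n E' a b" "edge n E' b c" "edge n E' c d" "edge n E' d a"
    using quad_facts(3) by (simp_all add: edge_flip quad_facts(2) doubleton_eq_iff)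
  show "edge n E' b d" using k E'_simps(1) by (auto simp: edge_def)
qed

lemma column: 
  "r \<in> {1..n} \<Longrightarrow> quad_at n M f E B j p q u v \<Longrightarrow>
    B r j = of_bool (E r = {p, q}) + of_bool (E r = {u, v}) - of_bool (E r = {q, u}) - of_bool (E r = {v, p})"
  "r \<in> M \<Longrightarrow> quad_at n M f E B j p q u v \<Longrightarrow> 2 * B r j = f r q u + f r v p - f r p q - f r u v"
  by (auto simp: quad_at_def)

lemma ptolemy: "r \<in> M \<Longrightarrow> f r a c + f r b d = max (f r a b + f r c d) (f r b c + f r d a)"
  "r \<in> M \<Longrightarrow> f r p q = f r q p"
  using trop quad_facts(1) unfolding tropical_def by blast+

lemma mutate_entry: "i \<noteq> k \<Longrightarrow> j \<noteq> k \<Longrightarrow> B' i j = B i j + sgn (B i k) * max (B i k * B k j) 0"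
  "B' k j = - B k j" "B' i k = - B i k"
  by (auto simp: B'_def mutate_matrix_def)

text \<open>The quadrilateral stays, but is read from its other diagonal. This shift by one vertex
  interchanges the two pairs of opposite sides, which accounts for the sign change of column
  \<open>k\<close>.\<close>

lemma flip_quad_self: "quad_at n M f E' B' k b c d a"
proof -
  have "B' i k = of_bool (E' i = {b, c}) + of_bool (E' i = {d, a}) - of_bool (E' i = {c, d}) - of_bool (E' i = {a, b})"
    if "i \<in> {1..n}" for i
    using column(1)[OF that qk] quad_facts(2,3) E'_simps
    by (cases "i = k") (auto simp: mutate_entry doubleton_eq_iff)
  moreover have "2 * B' r k = f r c d + f r a b - f r b c - f r d a" if "r \<in> M" for r
    using column(2)[OF that qk] by (simp add: mutate_entry)
  ultimately show ?thesis
    using quad_facts(4) quad_rotate[OF quad_facts(1)] flip_sides E'_simps by (simp add: quad_at_def)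
qed

text \<open>By skew-symmetry \<open>E k\<close> is no side of the quadrilateral around
  \<open>j\<close>, so this quadrilateral survives. None of its sides is \<open>bd\<close>, because
  \<open>bd\<close> crosses \<open>ac\<close> and edges of a triangulation do not.\<close>

lemma flip_quad_other:
  assumes j: "j \<in> {1..n}" "j \<noteq> k" "B j k = 0"
  shows "\<exists>p q u v. quad_at n M f E' B' j p q u v"
proof -
  obtain p q u v where qj: "quad_at n M f E B j p q u v" by (rule triangulation_quad[OF j(1)])
  have bkj: "B k j = 0" using triangulation_skew[OF k j(1)] j(3) by simp
  have dj: "distinct [p, q, u, v]" by (rule quad_atD(11)[OF qj])
  have ac: "E k \<noteq> {p, q}" "E k \<noteq> {q, u}" "E k \<noteq> {u, v}" "E k \<noteq> {v, p}"
    using column(1)[OF k qj] bkj unfolding sides_sign[OF dj] by (simp_all split: if_splits)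
  have bd: "edge n E x y \<Longrightarrow> {x, y} \<noteq> {b, d}" for x y
    using edge_not_crosses[OF _ k, of x y a c] quad_facts(1,2) quad_crosses[of a b c d] crosses_sym
    by (metis doubleton_eq_iff)
  have e: "edge n E p q" "edge n E q u" "edge n E u v" "edge n E v p" using quad_atD[OF qj] by blast+
  have "B' i j = of_bool (E' i = {p, q}) + of_bool (E' i = {u, v}) - of_bool (E' i = {q, u}) - of_bool (E' i = {v, p})"
    if "i \<in> {1..n}" for i
  proof (cases "i = k")
    case True
    then show ?thesis using bkj bd[OF e(1)] bd[OF e(2)] bd[OF e(3)] bd[OF e(4)] E'_simps(1)
      by (simp add: mutate_entry insert_commute)
  next
    case False
    then show ?thesis using bkj column(1)[OF that qj] j(2) E'_simps(2) by (simp add: mutate_entry)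
  qed
  moreover have "2 * B' r j = f r q u + f r v p - f r p q - f r u v" if "r \<in> M" for r
  proof -
    have "r \<noteq> k" using that k M by auto
    then show ?thesis using column(2)[OF that qj] bkj j(2) by (simp add: mutate_entry)
  qed
  moreover have "edge n E' p q" "edge n E' q u" "edge n E' u v" "edge n E' v p"
    by (rule edge_flip; fact)+
  ultimately have "quad_at n M f E' B' j p q u v"
    using quad_atD(1-6)[OF qj] j(2) E'_simps(2) by (simp add: quad_at_def)
  then show ?thesis by blast
qed

text \<open>The vertex \<open>d\<close> replaces \<open>c\<close>. For a row \<open>r\<close> in
  \<open>M\<close>, the entry \<open>B k j = -1\<close> makes the mutation add
  \<open>min (B r k) 0\<close>; this is the tropical Ptolemy relation solved for
  \<open>f r b d\<close>.\<close>

lemma flip_quad_ab: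
  assumes j: "j \<in> {1..n}" "j \<noteq> k" "E j = {a, b}"
  shows "\<exists>p q u v. quad_at n M f E' B' j p q u v"
proof -
  obtain e where qj: "quad_at n M f E B j a e b c" using quad_at_side_ab(1)[OF k j(1) qk j(3)] by blast
  have bkj: "B k j = -1" using quad_at_side_ab(2)[OF k j(1) qk j(3)] triangulation_skew[OF k j(1)] by simp
  have dj: "distinct [a, e, b, c]" by (rule quad_atD(11)[OF qj])
  have q: "quad a e b d" by (rule quad_flip_ab[OF quad_facts(1) quad_atD(1)[OF qj]])
  note dq = quad_distinct[OF q]
  have "B' i j = of_bool (E' i = {a, e}) + of_bool (E' i = {b, d}) - of_bool (E' i = {e, b}) - of_bool (E' i = {d, a})"
    if i: "i \<in> {1..n}" for i
  proof (cases "i = k")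
    case True
    then show ?thesis using bkj dq E'_simps(1) quad_facts(3)
      by (auto simp: mutate_entry doubleton_eq_iff)
  next
    case False
    have "E i \<noteq> {c, a}" using triangulation_inj[OF i k] False quad_facts(2) by auto
    then have 1: "B i j = of_bool (E i = {a, e}) + of_bool (E i = {b, c}) - of_bool (E i = {e, b})"
      using column(1)[OF i qj] by simp
    have 2: "B i k = of_bool (E i = {a, b}) + of_bool (E i = {c, d}) - of_bool (E i = {b, c}) - of_bool (E i = {d, a})"
      by (rule column(1)[OF i qk])
    have 3: "sgn (B i k) * max (- B i k) 0 = - of_bool (E i = {b, c}) - of_bool (E i = {d, a})"
      by (rule sides_sign_parts(4)[OF quad_facts(3) 2])
    show ?thesis using False j(2) new_diagonal_fresh[OF i]
      by (simp add: mutate_entry E'_simps(2) bkj 3 1)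
  qed
  moreover have "2 * B' r j = f r e b + f r d a - f r a e - f r b d" if r: "r \<in> M" for r
  proof -
    have "r \<noteq> k" using r k M by auto
    have 1: "2 * B r j = f r e b + f r c a - f r a e - f r b c" by (rule column(2)[OF r qj])
    have 2: "2 * B r k = f r b c + f r d a - f r a b - f r c d" by (rule column(2)[OF r qk])
    have 3: "sgn (B r k) * max (- B r k) 0 = min (B r k) 0" by (auto simp: sgn_if max_def min_def)
    show ?thesis
      using \<open>r \<noteq> k\<close> j(2) 1 2 3 ptolemy(1)[OF r] ptolemy(2)[OF r, of c a] bkj
      by (simp add: mutate_entry max_def min_def split: if_splits)
  qed
  moreover have "edge n E' a e" "edge n E' e b"
    using quad_atD(7,8)[OF qj] dj quad_facts(3) by (simp_all add: edge_flip quad_facts(2) doubleton_eq_iff)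
  ultimately have "quad_at n M f E' B' j a e b d"
    using quad_atD(4)[OF qj] q flip_sides(4,5) j(2,3) quad_facts(4) E'_simps(2) by (simp add: quad_at_def)
  then show ?thesis by blast
qed

text \<open>Here \<open>d\<close> replaces \<open>a\<close>, and \<open>B k j = 1\<close> turns the
  correction in a row of \<open>M\<close> into \<open>max (B r k) 0\<close>.\<close>

lemma flip_quad_bc:
  assumes j: "j \<in> {1..n}" "j \<noteq> k" "E j = {b, c}"
  shows "\<exists>p q u v. quad_at n M f E' B' j p q u v"
proof -
  obtain e where qj: "quad_at n M f E B j b e c a" using quad_at_side_bc(1)[OF k j(1) qk j(3)] by blast
  have bkj: "B k j = 1" using quad_at_side_bc(2)[OF k j(1) qk j(3)] triangulation_skew[OF k j(1)] by simp
  have dj: "distinct [b, e, c, a]" by (rule quad_atD(11)[OF qj])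
  have q: "quad b e c d" by (rule quad_flip_bc[OF quad_facts(1) quad_atD(1)[OF qj]])
  note dq = quad_distinct[OF q]
  have "B' i j = of_bool (E' i = {b, e}) + of_bool (E' i = {c, d}) - of_bool (E' i = {e, c}) - of_bool (E' i = {d, b})"
    if i: "i \<in> {1..n}" for i
  proof (cases "i = k")
    case True
    then show ?thesis using bkj dq E'_simps(1) quad_facts(3)
      by (auto simp: mutate_entry doubleton_eq_iff)
  next
    case False
    have "E i \<noteq> {c, a}" using triangulation_inj[OF i k] False quad_facts(2) by auto
    then have 1: "B i j = of_bool (E i = {b, e}) - of_bool (E i = {e, c}) - of_bool (E i = {a, b})"
      using column(1)[OF i qj] by simp
    have 2: "B i k = of_bool (E i = {a, b}) + of_bool (E i = {c, d}) - of_bool (E i = {b, c}) - of_bool (E i = {d, a})"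
      by (rule column(1)[OF i qk])
    have 3: "sgn (B i k) * max (B i k) 0 = of_bool (E i = {a, b}) + of_bool (E i = {c, d})"
      by (rule sides_sign_parts(3)[OF quad_facts(3) 2])
    show ?thesis using False j(2) new_diagonal_fresh[OF i]
      by (simp add: mutate_entry E'_simps(2) bkj 3 1 insert_commute)
  qed
  moreover have "2 * B' r j = f r e c + f r d b - f r b e - f r c d" if r: "r \<in> M" for r
  proof -
    have "r \<noteq> k" using r k M by auto
    have 1: "2 * B r j = f r e c + f r a b - f r b e - f r c a" by (rule column(2)[OF r qj])
    have 2: "2 * B r k = f r b c + f r d a - f r a b - f r c d" by (rule column(2)[OF r qk])
    have 3: "sgn (B r k) * max (B r k) 0 = max (B r k) 0" by (auto simp: sgn_if max_def)
    show ?thesis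
      using \<open>r \<noteq> k\<close> j(2) 1 2 3 ptolemy(1)[OF r] ptolemy(2)[OF r, of c a] ptolemy(2)[OF r, of d b] bkj
      by (simp add: mutate_entry max_def split: if_splits)
  qed
  moreover have "edge n E' b e" "edge n E' e c"
    using quad_atD(7,8)[OF qj] dj quad_facts(3) by (simp_all add: edge_flip quad_facts(2) doubleton_eq_iff)
  moreover have "edge n E' d b" using flip_sides(5) by (simp add: edge_commute)
  ultimately have "quad_at n M f E' B' j b e c d"
    using quad_atD(4)[OF qj] q flip_sides(3) j(2,3) quad_facts(4) E'_simps(2) by (simp add: quad_at_def)
  then show ?thesis by blast
qed

end

end

lemma triangulation_flip:
  assumes tri: "triangulation n M f E B" and k: "k \<in> {1..n}" and qk: "quad_at n M f E B k a b c d"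
    and M: "M \<inter> {1..n} = {}" and trop: "\<And>r. r \<in> M \<Longrightarrow> tropical (f r)"
  shows "triangulation n M f (E(k := {b, d})) (mutate_matrix k B)"
proof -
  let ?E = "E(k := {b, d})"
  note fresh = new_diagonal_fresh[OF tri k qk M trop]
  note qf = quad_facts[OF tri k qk M trop]
  \<comment> \<open>Read from its opposite vertex, the quadrilateral has \<open>cd\<close> and
    \<open>da\<close> in the places of \<open>ab\<close> and \<open>bc\<close>, so the same two
    lemmas also treat these sides.\<close>
  have qk': "quad_at n M f E B k c d a b" by (rule quad_at_rotate[OF qk])
  have E: "E(k := {d, b}) = ?E" by (simp add: insert_commute)
  have "inj_on ?E {1..n}"
    unfolding inj_on_def using triangulation_inj[OF tri] fresh by (metis fun_upd_apply)
  moreover have "mutate_matrix k B i j = - mutate_matrix k B j i" if "i \<in> {1..n}" "j \<in> {1..n}" for i j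
  proof -
    have sk: "B i j = - B j i" "B k j = - B j k" "B k i = - B i k"
      using triangulation_skew[OF tri] that k by blast+
    \<comment> \<open>The correction term is skew: it is nonzero only if \<open>x\<close> and
      \<open>y\<close> have opposite signs, and then exchanging them reverses the leading
      sign.\<close>
    have neg: "sgn x * max (x * - y) 0 = - (sgn y * max (y * - x) 0)" for x y :: int
    proof (cases "x * y < 0")
      case True
      then have "sgn x = - sgn y" by (auto simp: mult_less_0_iff)
      then show ?thesis by (simp add: mult.commute)
    next
      case False
      then have "max (x * - y) 0 = 0" "max (y * - x) 0 = 0" by (simp_all add: mult.commute)
      then show ?thesis by (simp only: mult_zero_right minus_zero)
    qed
    show ?thesis
      using neg[of "B i k" "B j k"] sk by (simp add: mutate_matrix_def)
  qed
  moreover have "\<exists>p q u v. quad_at n M f ?E (mutate_matrix k B) j p q u v" if j: "j \<in> {1..n}" for j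
  proof (cases "j = k")
    case True
    then show ?thesis using flip_quad_self[OF tri k qk M trop] by blast
  next
    case False
    have "B j k \<noteq> 0 \<Longrightarrow> E j = {a, b} \<or> E j = {c, d} \<or> E j = {b, c} \<or> E j = {d, a}"
      using trans[OF column(1)[OF tri k qk M trop j qk] sides_sign[OF qf(3)]] by (metis (full_types))
    then show ?thesis
      using flip_quad_other[OF tri k qk M trop j False] flip_quad_ab[OF tri k qk M trop j False]
        flip_quad_bc[OF tri k qk M trop j False] flip_quad_ab[OF tri k qk' M trop j False]
        flip_quad_bc[OF tri k qk' M trop j False] unfolding E by blast
  qed
  moreover have "\<not> crosses u v p q" if ij: "i \<in> {1..n}" "j \<in> {1..n}" "?E i = {u, v}" "?E j = {p, q}" for i j u v p q
  proof -
    have *: "\<not> crosses b d x y" if "l \<in> {1..n}" "l \<noteq> k" "E l = {x, y}" for l x y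
    proof
      assume "crosses b d x y"
      moreover have "edge n E a b" "edge n E b c" "edge n E c d" "edge n E d a" using quad_atD[OF qk] by blast+
      ultimately have "{x, y} = {a, c}"
        using edge_not_crosses[OF tri _ that(1,3)] crosses_diagonal[OF qf(1)] by blast
      then show False using that triangulation_inj[OF tri that(1) k] qf(2) by simp
    qed
    consider "i = k" "j = k" | "i = k" "j \<noteq> k" | "i \<noteq> k" "j = k" | "i \<noteq> k" "j \<noteq> k" by blast
    then show ?thesis
    proof cases
      case 1
      then show ?thesis using ij by (auto simp: doubleton_eq_iff crosses_self)
    next
      case 2
      then show ?thesis using ij *[of j p q] by (auto simp: doubleton_eq_iff crosses_sym(2)[of u])
    next
      case 3
      then show ?thesis using ij *[of i u v] crosses_sym by (auto simp: doubleton_eq_iff)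
    next
      case 4
      then show ?thesis using ij triangulation_not_crosses[OF tri] by simp
    qed
  qed
  ultimately show ?thesis unfolding triangulation_def by blast
qed

text \<open>The fan of all diagonals at vertex 0. The quadrilateral around the diagonal
  \<open>k\<close> has the diagonals \<open>k - 1\<close> and \<open>k + 1\<close> as sides; at the
  two ends of the fan these are boundary segments.\<close>

lemma triangulation_linear:
  "triangulation n {} f (\<lambda>i. {0, i + 1}) (linear_A_matrix n)"
proof -
  have "quad_at n {} f (\<lambda>i. {0, i + 1}) (linear_A_matrix n) k 0 k (k + 1) (k + 2)" if "k \<in> {1..n}" for k
  proof -
    have "edge n (\<lambda>i. {0, i + 1}) 0 k" 
    proof (cases "k = 1")
      case False
      then show ?thesis using that by (auto simp: edge_def intro!: bexI[of _ "k - 1"])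
    qed (simp add: edge_def boundary_def)
    then show ?thesis using that
      by (auto simp: quad_at_def quad_def cyc_def edge_def boundary_def linear_A_matrix_def doubleton_eq_iff)
  qed
  moreover have "\<not> crosses u v p q" if "{0, i + 1} = {u, v}" "{0, j + 1} = {p, q}" for i j u v p q :: nat
    using that by (auto simp: doubleton_eq_iff crosses_def cyc_def)
  moreover have "inj_on (\<lambda>i. {0, i + 1}) {1..n}"
    by (auto simp: inj_on_def doubleton_eq_iff)
  moreover have "linear_A_matrix n i j = - linear_A_matrix n j i" for i j
    by (simp add: linear_A_matrix_def)
  ultimately show ?thesis unfolding triangulation_def by blast
qed

lemma exchange_matrix_type_A_triangulation:
  assumes "exchange_matrix_type_A n B"
  obtains E where "triangulation n {} f E B"
proof -
  from assms have "\<exists>E. triangulation n {} f E B"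
  proof induction
    case base
    then show ?case using triangulation_linear by blast
  next
    case (mutate B k)
    then obtain E where E: "triangulation n {} f E B" by blast
    obtain a b c d where "quad_at n {} f E B k a b c d" by (rule triangulation_quad[OF E mutate.hyps(2)])
    then show ?case using triangulation_flip[OF E mutate.hyps(2)] by blast
  qed
  then show thesis using that by blast
qed

section \<open>Valuations of cluster variables\<close>

text \<open>
  The lamination of a diagonal \<open>uv\<close> is \<open>uv\<close> with both ends moved slightly backwards, so that it
  separates the vertices in the half-open arc \<open>[u, v)\<close> from the others.
\<close>

definition arc :: "nat \<Rightarrow> nat \<Rightarrow> nat \<Rightarrow> bool" where
  "arc u v x \<longleftrightarrow> x = u \<or> cyc u x v"

definition lamination :: "nat \<Rightarrow> nat \<Rightarrow> nat \<Rightarrow> nat \<Rightarrow> int" where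
  "lamination u v p q = (if arc u v p = arc u v q then 0 else 1)"

text \<open>The value -1 of a diagonal on itself matches the denominator vector \<open>-e_i\<close>
  of an initial variable. It also saves the Ptolemy relation when \<open>uv\<close> is a diagonal of
  the quadrilateral, where the left side is -1 + 1 and all sides contribute 0.\<close>

definition crossing :: "nat \<Rightarrow> nat \<Rightarrow> nat \<Rightarrow> nat \<Rightarrow> int" where
  "crossing u v p q =
    (if u = p \<and> v = q \<or> u = q \<and> v = p then -1 else if crosses u v p q then 1 else 0)"

lemma lamination_commute: "u \<noteq> v \<Longrightarrow> lamination u v = lamination v u"
  unfolding fun_eq_iff lamination_def arc_def cyc_def by (smt (verit))

lemma lamination_swap: "lamination u v p q = lamination u v q p"
  by (auto simp: lamination_def)

lemma tropical_lamination:
  assumes "u \<noteq> v" shows "tropical (lamination u v)"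
proof -
  have "lamination u v a c + lamination u v b d = max (lamination u v a b + lamination u v c d) (lamination u v b c + lamination u v d a)"
    if "quad a b c d" for a b c d
    using that assms unfolding quad_def lamination_def arc_def cyc_def max_def by (smt (verit))
  then show ?thesis using lamination_swap unfolding tropical_def by blast
qed

lemma tropical_crossing:
  assumes "u \<noteq> v" shows "tropical (crossing u v)"
proof -
  have "crossing u v a c + crossing u v b d = max (crossing u v a b + crossing u v c d) (crossing u v b c + crossing u v d a)"
    if "quad a b c d" for a b c d
    using that assms unfolding quad_def crosses_def crossing_def cyc_def max_def by (smt (verit))
  moreover have "crossing u v p q = crossing u v q p" for p q
    by (auto simp: crossing_def crosses_sym(3))
  ultimately show ?thesis unfolding tropical_def by blast
qed

text \<open>Together with \<open>lamination_not_crossing\<close> this produces the identity block of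
  principal coefficients: the shear coordinates of the laminations of the initial diagonals,
  doubled, are 2 on the diagonal and 0 off it.\<close>

lemma lamination_diagonal: "quad a b c d \<Longrightarrow> lamination a c b c + lamination a c d a - lamination a c a b - lamination a c c d = 2"
  unfolding quad_def lamination_def arc_def cyc_def by (smt (verit))

text \<open>The half-open arc of such a \<open>uv\<close> cuts off at most one vertex of the
  quadrilateral, and the two sides at that vertex enter with opposite signs.\<close>

lemma lamination_not_crossing:
  assumes "quad a b c d" "u \<noteq> v" "{u, v} \<noteq> {a, c}" "\<not> crosses u v a c"
    "\<not> crosses u v a b" "\<not> crosses u v b c" "\<not> crosses u v c d" "\<not> crosses u v d a"
  shows "lamination u v b c + lamination u v d a - lamination u v a b - lamination u v c d = 0"
proof -
  have "\<not> (u = a \<and> v = c)" "\<not> (u = c \<and> v = a)" using assms(3) by auto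
  then show ?thesis
    using assms(1,2,4-) unfolding quad_def crosses_def lamination_def arc_def cyc_def by (smt (verit))
qed

definition shear :: "(nat \<Rightarrow> nat \<Rightarrow> int) \<Rightarrow> nat \<Rightarrow> nat \<Rightarrow> nat \<Rightarrow> nat \<Rightarrow> int" where
  "shear f a b c d = f b c + f d a - f a b - f c d"

text \<open>
  The values \<open>F p q\<close> that a valuation with weights \<open>w\<close> must take on the cluster variables, by the
  tropicalised exchange relations. These are doubled as \<open>shear\<close> is twice an exchange matrix entry.
\<close>

definition compatible ::
  "nat \<Rightarrow> (nat \<Rightarrow> nat \<Rightarrow> nat \<Rightarrow> int) \<Rightarrow> (nat \<Rightarrow> nat set) \<Rightarrow> (nat \<Rightarrow> int) \<Rightarrow> (nat \<Rightarrow> nat \<Rightarrow> int) \<Rightarrow> bool" where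
  "compatible n f E0 w F \<longleftrightarrow>
     (\<forall>p q. F p q = F q p) \<and>
     (\<forall>p q. p \<le> n + 2 \<longrightarrow> q \<le> n + 2 \<longrightarrow> boundary n p q \<longrightarrow> F p q = 0) \<and>
     (\<forall>i\<in>{1..n}. \<forall>p q. E0 i = {p, q} \<longrightarrow> w i = F p q) \<and>
     (\<forall>a b c d. quad a b c d \<longrightarrow> {a, b, c, d} \<subseteq> {..n + 2} \<longrightarrow>
       2 * (F a c + F b d) =
       min (2 * (F a b + F c d) + (\<Sum>i=1..n. max (shear (f (n + i)) a b c d) 0 * w (n + i)))
           (2 * (F b c + F d a) + (\<Sum>i=1..n. max (- shear (f (n + i)) a b c d) 0 * w (n + i))))"

lemma sum_split_2n: "(\<Sum>i=1..2*n. h i) = (\<Sum>i=1..n. h i) + (\<Sum>i=1..n. h (n + i))" for h :: "nat \<Rightarrow> int"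
proof -
  have "(\<Sum>i=1..2*n. h i) = (\<Sum>i=1..n. h i) + (\<Sum>i=n+1..n+n. h i)"
    using sum.ub_add_nat[of 1 n h n] by (simp add: mult_2)
  also have "(\<Sum>i=n+1..n+n. h i) = (\<Sum>i=1..n. h (n + i))"
    using sum.shift_bounds_cl_nat_ivl[of h 1 n n] by (simp add: add.commute)
  finally show ?thesis .
qed

lemma val_exchange_monomial:
  fixes n :: nat
  assumes "\<And>i. i \<in> {1..2*n} \<Longrightarrow> subtraction_free (x i)"
  shows "val w (\<Prod>i=1..2*n. x i ^ nat (max (h i) 0)) = (\<Sum>i=1..2*n. max (h i) 0 * val w (x i))"
  using assms by (subst val_prod) (auto simp: subtraction_free_nonzero val_power)

text \<open>The invariant of the induction over the path from the initial seed. Quantifying over all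
  \<open>w\<close> and \<open>F\<close> inside makes one triangulation serve crossing numbers and
  degrees simultaneously.\<close>

definition seed_model where
  "seed_model n f E0 s \<longleftrightarrow> (\<exists>E. triangulation n {n+1..n+n} f E (snd s) \<and>
     (\<forall>l\<in>{1..2*n}. subtraction_free (fst s l)) \<and> (\<forall>l\<in>{n+1..n+n}. fst s l = gen l) \<and>
     (\<forall>w F. compatible n f E0 w F \<longrightarrow>
        (\<forall>l\<in>{1..n}. \<forall>p q. E l = {p, q} \<longrightarrow> val w (fst s l) = F p q)))"

lemma seed_model_mutate:
  assumes "seed_model n f E0 (x, B)" and k: "k \<in> {1..n}"
    and trop: "\<And>r. r \<in> {n+1..n+n} \<Longrightarrow> tropical (f r)"
  shows "seed_model n f E0 (mutate_seed (2 * n) k (x, B))"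
proof -
  obtain E where tri: "triangulation n {n+1..n+n} f E B"
    and sf: "\<And>l. l \<in> {1..2*n} \<Longrightarrow> subtraction_free (x l)"
    and xg: "\<And>l. l \<in> {n+1..n+n} \<Longrightarrow> x l = gen l"
    and xF: "\<And>w F l p q. compatible n f E0 w F \<Longrightarrow> l \<in> {1..n} \<Longrightarrow> E l = {p, q} \<Longrightarrow> val w (x l) = F p q"
    using assms(1) unfolding seed_model_def by auto
  obtain a b c d where q: "quad_at n {n+1..n+n} f E B k a b c d" by (rule triangulation_quad[OF tri k])
  note qd = quad_atD[OF q]
  define P where "P = (\<Prod>i=1..2*n. x i ^ nat (max (B i k) 0))"
  define N where "N = (\<Prod>i=1..2*n. x i ^ nat (max (- B i k) 0))"
  define x' where "x' = x(k := inverse (x k) * (P + N))"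
  have k2: "k \<in> {1..2*n}" using k by auto
  have sfPN: "subtraction_free P" "subtraction_free N"
    unfolding P_def N_def using sf by (auto intro!: subtraction_free_prod subtraction_free_power)
  have sfk: "subtraction_free (inverse (x k) * (P + N))"
    by (intro subtraction_free_mult subtraction_free_inverse subtraction_free_add sfPN sf[OF k2])
  have "triangulation n {n+1..n+n} f (E(k := {b, d})) (mutate_matrix k B)"
    using triangulation_flip[OF tri k q _ trop] by auto
  moreover have "\<forall>l\<in>{1..2*n}. subtraction_free (x' l)"
    using sf sfk by (auto simp: x'_def)
  moreover have "\<forall>l\<in>{n+1..n+n}. x' l = gen l"
    using xg k by (auto simp: x'_def)
  moreover have "val w (x' l) = F u v"
    if cF: "compatible n f E0 w F" and l: "l \<in> {1..n}" "(E(k := {b, d})) l = {u, v}" for w F l u v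
  proof (cases "l = k")
    case False
    then show ?thesis using l xF[OF cF] by (simp add: x'_def)
  next
    case True
    have F_sym: "F p q = F q p" for p q using cF by (simp add: compatible_def)
    \<comment> \<open>Boundary segments carry no cluster variable and contribute nothing to the sum,
      in accordance with the vanishing of \<open>F\<close> on them.\<close>
    have F_edge: "(\<Sum>i=1..n. of_bool (E i = {p, q}) * val w (x i)) = F p q"
      if e: "edge n E p q" "p \<le> n + 2" "q \<le> n + 2" for p q
    proof (cases "\<exists>i\<in>{1..n}. E i = {p, q}")
      case True
      then obtain i where i: "i \<in> {1..n}" "E i = {p, q}" by blast
      have "(\<Sum>j=1..n. of_bool (E j = {p, q}) * val w (x j)) = (\<Sum>j=1..n. if j = i then val w (x j) else 0)"
      proof (rule sum.cong)
        fix j assume "j \<in> {1..n}"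
        then have "E j = {p, q} \<longleftrightarrow> j = i" using triangulation_inj[OF tri _ i(1)] i(2) by metis
        then show "of_bool (E j = {p, q}) * val w (x j) = (if j = i then val w (x j) else 0)" by simp
      qed simp
      also have "\<dots> = F p q" using i xF[OF cF i] by simp
      finally show ?thesis .
    next
      case False
      then have "boundary n p q" using e by (simp add: edge_def)
      then have "F p q = 0" using cF e by (simp add: compatible_def)
      moreover have "(\<Sum>i=1..n. of_bool (E i = {p, q}) * val w (x i)) = 0"
        by (rule sum.neutral) (use False in auto)
      ultimately show ?thesis by simp
    qed
    have col: "B i k = of_bool (E i = {a, b}) + of_bool (E i = {c, d}) - of_bool (E i = {b, c}) - of_bool (E i = {d, a})"
      if "i \<in> {1..n}" for i
      using q that by (simp add: quad_at_def)
    have col2: "2 * B (n + i) k = shear (f (n + i)) a b c d" if "i \<in> {1..n}" for i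
      using q that by (simp add: quad_at_def shear_def)
    have "(\<Sum>i=1..n. max (B i k) 0 * val w (x i)) =
        (\<Sum>i=1..n. of_bool (E i = {a, b}) * val w (x i) + of_bool (E i = {c, d}) * val w (x i))"
      by (rule sum.cong[OF refl], subst sides_sign_parts(1)[OF qd(11) col]) (assumption, rule distrib_right)
    also have "\<dots> = F a b + F c d" unfolding sum.distrib using F_edge qd by simp
    finally have P1: "(\<Sum>i=1..n. max (B i k) 0 * val w (x i)) = F a b + F c d" .
    have "(\<Sum>i=1..n. max (- B i k) 0 * val w (x i)) =
        (\<Sum>i=1..n. of_bool (E i = {b, c}) * val w (x i) + of_bool (E i = {d, a}) * val w (x i))"
      by (rule sum.cong[OF refl], subst sides_sign_parts(2)[OF qd(11) col]) (assumption, rule distrib_right)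
    also have "\<dots> = F b c + F d a" unfolding sum.distrib using F_edge qd by simp
    finally have N1: "(\<Sum>i=1..n. max (- B i k) 0 * val w (x i)) = F b c + F d a" .
    have m2: "2 * max y 0 = max (2 * y) 0" for y :: int by (simp add: max_def)
    have P2: "2 * (\<Sum>i=1..n. max (B (n + i) k) 0 * val w (x (n + i))) =
        (\<Sum>i=1..n. max (shear (f (n + i)) a b c d) 0 * w (n + i))"
      unfolding sum_distrib_left mult.assoc[symmetric] m2
      by (rule sum.cong) (use col2 xg in \<open>auto simp: val_gen\<close>)
    have N2: "2 * (\<Sum>i=1..n. max (- B (n + i) k) 0 * val w (x (n + i))) =
        (\<Sum>i=1..n. max (- shear (f (n + i)) a b c d) 0 * w (n + i))"
      unfolding sum_distrib_left mult.assoc[symmetric] m2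
      by (rule sum.cong) (use col2 xg in \<open>auto simp: val_gen\<close>)
    have "2 * val w P = 2 * (F a b + F c d) + (\<Sum>i=1..n. max (shear (f (n + i)) a b c d) 0 * w (n + i))"
      unfolding P_def by (simp only: val_exchange_monomial[OF sf] sum_split_2n P1 P2[symmetric] distrib_left)
    moreover have "2 * val w N = 2 * (F b c + F d a) + (\<Sum>i=1..n. max (- shear (f (n + i)) a b c d) 0 * w (n + i))"
      unfolding N_def by (simp only: val_exchange_monomial[OF sf, where h = "\<lambda>i. - B i k"] sum_split_2n N1 N2[symmetric] distrib_left)
    moreover have "2 * (F a c + F b d) =
       min (2 * (F a b + F c d) + (\<Sum>i=1..n. max (shear (f (n + i)) a b c d) 0 * w (n + i)))
           (2 * (F b c + F d a) + (\<Sum>i=1..n. max (- shear (f (n + i)) a b c d) 0 * w (n + i)))"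
      using cF qd(1,3-6) by (simp add: compatible_def)
    ultimately have "F a c + F b d = min (val w P) (val w N)" by (simp add: min_def split: if_splits)
    moreover have "val w (x' k) = - val w (x k) + min (val w P) (val w N)"
      unfolding x'_def using subtraction_free_nonzero sf[OF k2] subtraction_free_add[OF sfPN]
      by (simp add: val_mult val_inverse val_add[OF sfPN])
    moreover have "val w (x k) = F a c" by (rule xF[OF cF k qd(2)])
    moreover have "F u v = F b d" using l True F_sym by (auto simp: doubleton_eq_iff)
    ultimately show ?thesis using True by simp
  qed
  ultimately show ?thesis
    unfolding seed_model_def mutate_seed_def P_def[symmetric] N_def[symmetric] x'_def[symmetric] split fst_conv snd_conv
    by blast
qed

lemma seed_model_seed_at:
  assumes tri: "triangulation n {} g E0 B0" and E0: "\<And>i. i \<in> {1..n} \<Longrightarrow> E0 i = {\<alpha> i, \<beta> i}"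
    and f: "\<And>i. f (n + i) = lamination (\<alpha> i) (\<beta> i)" and t: "set t \<subseteq> {1..n}"
  shows "seed_model n f E0 (seed_at n B0 t)"
  using t
proof (induction t)
  case Nil
  have *: "quad_at n {n+1..n+n} f E0 (principal_extension n B0) k a b c d"
    if k: "k \<in> {1..n}" and q: "quad_at n {} g E0 B0 k a b c d" for k a b c d
  proof -
    note qd = quad_atD[OF q]
    have "2 * (if i = k then 1 else 0) = lamination (\<alpha> i) (\<beta> i) b c + lamination (\<alpha> i) (\<beta> i) d a
        - lamination (\<alpha> i) (\<beta> i) a b - lamination (\<alpha> i) (\<beta> i) c d" if i: "i \<in> {1..n}" for i
    proof (cases "i = k")
      case True
      then have "\<alpha> i = a \<and> \<beta> i = c \<or> \<alpha> i = c \<and> \<beta> i = a"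
        using E0[OF i] qd(2) by (metis doubleton_eq_iff)
      moreover have "a \<noteq> c" using qd(11) by simp
      ultimately have "lamination (\<alpha> i) (\<beta> i) = lamination a c" using lamination_commute by metis
      then show ?thesis using lamination_diagonal[OF qd(1)] True by simp
    next
      case False
      have "edge n E0 a c" using k qd(2) by (auto simp: edge_def)
      then have "\<not> crosses (\<alpha> i) (\<beta> i) a c" "\<not> crosses (\<alpha> i) (\<beta> i) a b" "\<not> crosses (\<alpha> i) (\<beta> i) b c"
        "\<not> crosses (\<alpha> i) (\<beta> i) c d" "\<not> crosses (\<alpha> i) (\<beta> i) d a"
        using edge_not_crosses[OF tri _ i E0[OF i]] qd crosses_sym(1) by blast+
      moreover have "\<alpha> i \<noteq> \<beta> i" by (rule diagonal_not_boundary(4)[OF tri i E0[OF i]])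
      moreover have "{\<alpha> i, \<beta> i} \<noteq> {a, c}"
        using triangulation_inj[OF tri i k] False E0[OF i] qd(2) by metis
      ultimately show ?thesis using lamination_not_crossing[OF qd(1)] False by simp
    qed
    note 1 = this
    have "2 * principal_extension n B0 r k = f r b c + f r d a - f r a b - f r c d" if "r \<in> {n+1..n+n}" for r
    proof -
      define i where "i = r - n"
      have "r = n + i" "i \<in> {1..n}" using that by (auto simp: i_def)
      then show ?thesis using 1[of i] k by (auto simp: principal_extension_def f)
    qed
    moreover have "principal_extension n B0 i k = B0 i k" if "i \<in> {1..n}" for i
      using that k by (simp add: principal_extension_def)
    ultimately show ?thesis using q by (simp add: quad_at_def)
  qed
  have "triangulation n {n+1..n+n} f E0 (principal_extension n B0)"
  proof -
    have "principal_extension n B0 i j = - principal_extension n B0 j i" if "i \<in> {1..n}" "j \<in> {1..n}" for i j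
      using that triangulation_skew[OF tri that] by (simp add: principal_extension_def)
    moreover have "\<exists>a b c d. quad_at n {n+1..n+n} f E0 (principal_extension n B0) k a b c d" if "k \<in> {1..n}" for k
      using *[OF that] triangulation_quad[OF tri that] by metis
    ultimately show ?thesis using tri unfolding triangulation_def by blast
  qed
  moreover have "val w (gen l) = F p q" if "compatible n f E0 w F" "l \<in> {1..n}" "E0 l = {p, q}" for w F l p q
    using that by (simp add: val_gen compatible_def)
  ultimately show ?case
    unfolding seed_model_def by (auto simp: subtraction_free_gen intro!: exI[of _ E0])
next
  case (Cons k t)
  have "tropical (f r)" if "r \<in> {n+1..n+n}" for r
  proof -
    have i: "r - n \<in> {1..n}" using that by auto
    have "\<alpha> (r - n) \<noteq> \<beta> (r - n)" by (rule diagonal_not_boundary(4)[OF tri i E0[OF i]])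
    then show ?thesis using f[of "r - n"] tropical_lamination that by simp
  qed
  then show ?case
    using seed_model_mutate[of n f E0 "fst (seed_at n B0 t)" "snd (seed_at n B0 t)" k] Cons by simp
qed

section \<open>Crossing numbers and shear coordinates\<close>

lemma crossing_boundary:
  assumes "boundary n p q" "p \<le> n + 2" "q \<le> n + 2" "u \<le> n + 2" "v \<le> n + 2" "\<not> boundary n u v"
  shows "crossing u v p q = 0"
proof -
  have "\<not> crosses u v p q" using boundary_not_crosses[OF assms(1,4,5)] crosses_sym(1) by blast
  then show ?thesis using assms(1,6) boundary_commute by (auto simp: crossing_def)
qed

text \<open>The weight vanishes on all coefficient variables, so what remains is the Ptolemy
  relation for \<open>crossing\<close>, whose maximum becomes a minimum under negation.\<close>

lemma compatible_crossing:
  assumes tri: "triangulation n {} g E0 B0" and i: "i \<in> {1..n}" "E0 i = {u, v}"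
  shows "compatible n f E0 (\<lambda>l. of_bool (l = i)) (\<lambda>p q. - crossing u v p q)"
proof -
  note uv = diagonal_not_boundary[OF tri i]
  note trop = tropical_crossing[OF uv(4)]
  have s: "- crossing u v p q = - crossing u v q p" for p q using trop unfolding tropical_def by simp
  have b: "- crossing u v p q = 0" if "p \<le> n + 2" "q \<le> n + 2" "boundary n p q" for p q
    using crossing_boundary[OF that(3,1,2) uv(2,3,1)] by simp
  have init: "of_bool (l = i) = - crossing u v p q" if l: "l \<in> {1..n}" "E0 l = {p, q}" for l p q
  proof (cases "l = i")
    case True
    then show ?thesis using l i by (auto simp: crossing_def doubleton_eq_iff)
  next
    case False
    then have "{u, v} \<noteq> {p, q}" using triangulation_inj[OF tri i(1) l(1)] i l by auto
    moreover have "\<not> crosses u v p q" by (rule triangulation_not_crosses[OF tri i(1) l(1) i(2) l(2)])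
    ultimately show ?thesis using False by (auto simp: crossing_def doubleton_eq_iff)
  qed
  have pt: "2 * (- crossing u v a c + - crossing u v b d) =
       min (2 * (- crossing u v a b + - crossing u v c d) + (\<Sum>l=1..n. max (shear (f (n + l)) a b c d) 0 * of_bool (n + l = i)))
           (2 * (- crossing u v b c + - crossing u v d a) + (\<Sum>l=1..n. max (- shear (f (n + l)) a b c d) 0 * of_bool (n + l = i)))"
    if "quad a b c d" for a b c d
  proof -
    have z: "(\<Sum>l=1..n. h l * of_bool (n + l = i)) = 0" for h :: "nat \<Rightarrow> int"
      by (rule sum.neutral) (use i in auto)
    have "crossing u v a c + crossing u v b d = max (crossing u v a b + crossing u v c d) (crossing u v b c + crossing u v d a)"
      using trop that unfolding tropical_def by blast
    then show ?thesis unfolding z by (simp add: max_def min_def split: if_splits)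
  qed
  show ?thesis
    unfolding compatible_def
    by (intro conjI allI impI ballI; (rule s | rule init | rule b | rule pt); assumption)
qed

text \<open>
  The \<open>j\<close>-th component of the \<open>g\<close>-vector of the diagonal \<open>pq\<close>, where \<open>abcd\<close> is the quadrilateral
  around the initial diagonal \<open>j\<close>: the shear coordinate of
  \<open>pq\<close> with both ends moved slightly forwards.
\<close>

definition g_coord :: "nat \<Rightarrow> nat \<Rightarrow> nat \<Rightarrow> nat \<Rightarrow> nat \<Rightarrow> nat \<Rightarrow> int" where
  "g_coord a b c d p q =
    (if arc a b p \<and> arc c d q \<or> arc a b q \<and> arc c d p then 1
     else if arc b c p \<and> arc d a q \<or> arc b c q \<and> arc d a p then -1 else 0)"

text \<open>The four half-open arcs of the quadrilateral partition the vertices, and the lamination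
  of a side is 1 iff exactly one of \<open>p\<close>, \<open>q\<close> lies in its arc. Ends in
  adjacent arcs cancel; ends in opposite arcs give 2 or -2.\<close>

lemma g_coord_lamination:
  "quad a b c d \<Longrightarrow> 2 * g_coord a b c d p q = lamination a b p q + lamination c d p q - lamination b c p q - lamination d a p q"
  unfolding quad_def g_coord_def lamination_def arc_def cyc_def by (smt (verit))

lemma g_coord_swap: "g_coord a b c d p q = g_coord a b c d q p"
  by (auto simp: g_coord_def)

lemma g_coord_rotate: "g_coord a b c d p q = g_coord c d a b p q"
  by (auto simp: g_coord_def)

lemma g_coord_boundary:
  assumes "quad a b c d" "a \<le> n + 2" "b \<le> n + 2" "c \<le> n + 2" "d \<le> n + 2" "boundary n p q"
  shows "g_coord a b c d p q = 0"
proof -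
  have "q = Suc p \<or> p = Suc q \<or> p = 0 \<and> q = n + 2 \<or> q = 0 \<and> p = n + 2"
    using assms(6) by (auto simp: boundary_def doubleton_eq_iff)
  then show ?thesis using assms(1-5) unfolding quad_def g_coord_def arc_def cyc_def by (smt (verit))
qed

lemma g_coord_diagonal: "quad a b c d \<Longrightarrow> g_coord a b c d a c = 1"
  unfolding quad_def g_coord_def arc_def cyc_def by (smt (verit))

lemma g_coord_not_crossing:
  assumes "quad a b c d" "u \<noteq> v" "{u, v} \<noteq> {a, c}" "\<not> crosses u v a c"
    "\<not> crosses u v a b" "\<not> crosses u v b c" "\<not> crosses u v c d" "\<not> crosses u v d a"
  shows "g_coord a b c d u v = 0"
proof -
  have "\<not> (u = a \<and> v = c)" "\<not> (u = c \<and> v = a)" using assms(3) by auto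
  then show ?thesis
    using assms(1,2,4-) unfolding quad_def crosses_def g_coord_def arc_def cyc_def by (smt (verit))
qed

text \<open>The lamination of a boundary segment separates a single vertex from all others, and the
  two sides meeting there cancel.\<close>

lemma shear_lamination_boundary:
  assumes "quad a b c d" "a \<le> n + 2" "b \<le> n + 2" "c \<le> n + 2" "d \<le> n + 2" "boundary n u v"
  shows "shear (lamination u v) a b c d = 0"
proof -
  have "v = Suc u \<or> u = Suc v \<or> u = 0 \<and> v = n + 2 \<or> v = 0 \<and> u = n + 2"
    using assms(6) by (auto simp: boundary_def doubleton_eq_iff)
  then show ?thesis using assms(1-5) unfolding quad_def shear_def lamination_def arc_def cyc_def by (smt (verit))
qed

text \<open>Allows a sum against a column of \<open>B0\<close>, which sees only diagonals, to be
  evaluated on all four sides of a quadrilateral, boundary segments included.\<close>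

lemma sum_over_edge:
  assumes tri: "triangulation n {} g E0 B0" and E0: "\<forall>i\<in>{1..n}. E0 i = {\<alpha> i, \<beta> i}"
    and e: "edge n E0 u v" "u \<noteq> v" and h: "\<And>x y. x \<noteq> y \<Longrightarrow> h x y = h y x" "boundary n u v \<Longrightarrow> h u v = 0"
  shows "(\<Sum>i=1..n. of_bool (E0 i = {u, v}) * h (\<alpha> i) (\<beta> i)) = (h u v :: int)"
proof (cases "\<exists>i\<in>{1..n}. E0 i = {u, v}")
  case True
  then obtain i where i: "i \<in> {1..n}" "E0 i = {u, v}" by blast
  have "\<alpha> i = u \<and> \<beta> i = v \<or> \<alpha> i = v \<and> \<beta> i = u" using bspec[OF E0 i(1)] i(2) by (metis doubleton_eq_iff)
  then have hi: "h (\<alpha> i) (\<beta> i) = h u v" using h(1)[OF e(2)] by auto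
  have "(\<Sum>j=1..n. of_bool (E0 j = {u, v}) * h (\<alpha> j) (\<beta> j)) = (\<Sum>j=1..n. if j = i then h (\<alpha> j) (\<beta> j) else 0)"
  proof (rule sum.cong)
    fix j assume "j \<in> {1..n}"
    then have "E0 j = {u, v} \<longleftrightarrow> j = i" using triangulation_inj[OF tri _ i(1)] i(2) by metis
    then show "of_bool (E0 j = {u, v}) * h (\<alpha> j) (\<beta> j) = (if j = i then h (\<alpha> j) (\<beta> j) else 0)" by simp
  qed simp
  also have "\<dots> = h u v" using i hi by simp
  finally show ?thesis .
next
  case False
  then have "h u v = 0" using e(1) h(2) by (simp add: edge_def)
  moreover have "(\<Sum>i=1..n. of_bool (E0 i = {u, v}) * h (\<alpha> i) (\<beta> i)) = 0"
    by (rule sum.neutral) (use False in auto)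
  ultimately show ?thesis by simp
qed

text \<open>The two right-hand sides are the doubled degrees of the two exchange monomials, so their
  equality is the homogeneity of the exchange relation. For each side of the quadrilateral around
  \<open>j\<close>, the positive or negative part of the shear is the defect in the Ptolemy relation
  of its lamination; the signed sum over the sides is the claim.\<close>

lemma g_coord_ptolemy:
  assumes tri: "triangulation n {} g E0 B0" and E0: "\<forall>i\<in>{1..n}. E0 i = {\<alpha> i, \<beta> i}"
    and qj: "quad_at n {} g E0 B0 j a b c d"
    and PQRS: "quad P Q R S" "{P, Q, R, S} \<subseteq> {..n + 2}"
  shows "2 * (g_coord a b c d P R + g_coord a b c d Q S) = 2 * (g_coord a b c d P Q + g_coord a b c d R S) +
      (\<Sum>i=1..n. max (shear (lamination (\<alpha> i) (\<beta> i)) P Q R S) 0 * B0 i j)" (is ?A)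
    and "2 * (g_coord a b c d P R + g_coord a b c d Q S) = 2 * (g_coord a b c d Q R + g_coord a b c d S P) +
      (\<Sum>i=1..n. max (- shear (lamination (\<alpha> i) (\<beta> i)) P Q R S) 0 * B0 i j)" (is ?B)
proof -
  note qd = quad_atD[OF qj]
  have sum: "(\<Sum>i=1..n. h (\<alpha> i) (\<beta> i) * B0 i j) = h a b + h c d - h b c - h d a"
    if h: "\<And>x y. x \<noteq> y \<Longrightarrow> h x y = h y x" "\<And>x y. boundary n x y \<Longrightarrow> h x y = 0" for h :: "nat \<Rightarrow> nat \<Rightarrow> int"
  proof -
    have e: "(\<Sum>i=1..n. of_bool (E0 i = {u, v}) * h (\<alpha> i) (\<beta> i)) = h u v"
      if "edge n E0 u v" "u \<noteq> v" for u v
      by (rule sum_over_edge[OF tri E0 that]) (erule h)+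
    have "(\<Sum>i=1..n. h (\<alpha> i) (\<beta> i) * B0 i j) =
      (\<Sum>i=1..n. of_bool (E0 i = {a, b}) * h (\<alpha> i) (\<beta> i) + of_bool (E0 i = {c, d}) * h (\<alpha> i) (\<beta> i)
        - of_bool (E0 i = {b, c}) * h (\<alpha> i) (\<beta> i) - of_bool (E0 i = {d, a}) * h (\<alpha> i) (\<beta> i))"
    proof (rule sum.cong[OF refl])
      fix i assume "i \<in> {1..n}"
      then have B: "B0 i j = of_bool (E0 i = {a, b}) + of_bool (E0 i = {c, d}) - of_bool (E0 i = {b, c}) - of_bool (E0 i = {d, a})"
        using qj by (simp add: quad_at_def)
      show "h (\<alpha> i) (\<beta> i) * B0 i j = of_bool (E0 i = {a, b}) * h (\<alpha> i) (\<beta> i) + of_bool (E0 i = {c, d}) * h (\<alpha> i) (\<beta> i)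
        - of_bool (E0 i = {b, c}) * h (\<alpha> i) (\<beta> i) - of_bool (E0 i = {d, a}) * h (\<alpha> i) (\<beta> i)"
        unfolding B by (simp add: algebra_simps)
    qed
    also have "\<dots> = h a b + h c d - h b c - h d a"
      unfolding sum.distrib sum_subtractf
      using e[OF qd(7)] e[OF qd(8)] e[OF qd(9)] e[OF qd(10)] qd(11) by simp
    finally show ?thesis .
  qed
  have pt: "lamination u v P R + lamination u v Q S = max (lamination u v P Q + lamination u v R S) (lamination u v Q R + lamination u v S P)" if "u \<noteq> v" for u v
    using tropical_lamination[OF that] PQRS(1) unfolding tropical_def by blast
  have sh: "max (shear (lamination u v) P Q R S) 0 = lamination u v P R + lamination u v Q S - lamination u v P Q - lamination u v R S"
    "max (- shear (lamination u v) P Q R S) 0 = lamination u v P R + lamination u v Q S - lamination u v Q R - lamination u v S P" if "u \<noteq> v" for u v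
    using pt[OF that] unfolding shear_def by linarith+
  have "shear (lamination x y) P Q R S = 0" if "boundary n x y" for x y
    using shear_lamination_boundary[OF PQRS(1) _ _ _ _ that] PQRS(2) by simp
  then have 1: "(\<Sum>i=1..n. max (shear (lamination (\<alpha> i) (\<beta> i)) P Q R S) 0 * B0 i j) =
      max (shear (lamination a b) P Q R S) 0 + max (shear (lamination c d) P Q R S) 0 - max (shear (lamination b c) P Q R S) 0 - max (shear (lamination d a) P Q R S) 0"
    and 2: "(\<Sum>i=1..n. max (- shear (lamination (\<alpha> i) (\<beta> i)) P Q R S) 0 * B0 i j) =
      max (- shear (lamination a b) P Q R S) 0 + max (- shear (lamination c d) P Q R S) 0 - max (- shear (lamination b c) P Q R S) 0 - max (- shear (lamination d a) P Q R S) 0"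
    using lamination_commute sum[of "\<lambda>x y. max (shear (lamination x y) P Q R S) 0"] sum[of "\<lambda>x y. max (- shear (lamination x y) P Q R S) 0"]
    by auto
  have ne: "a \<noteq> b" "b \<noteq> c" "c \<noteq> d" "d \<noteq> a" using qd(11) by auto
  note G = g_coord_lamination[OF qd(1)]
  show ?A unfolding 1 sh[OF ne(1)] sh[OF ne(2)] sh[OF ne(3)] sh[OF ne(4)]
    unfolding distrib_left G by simp
  show ?B unfolding 2 sh[OF ne(1)] sh[OF ne(2)] sh[OF ne(3)] sh[OF ne(4)]
    unfolding distrib_left G by simp
qed

text \<open>Both branches of the minimum coincide by \<open>g_coord_ptolemy\<close>, so the relation
  survives a change of sign of weights and values.\<close>

lemma compatible_g_coord:
  assumes tri: "triangulation n {} g E0 B0" and E0: "\<forall>i\<in>{1..n}. E0 i = {\<alpha> i, \<beta> i}"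
    and f: "\<And>i. f (n + i) = lamination (\<alpha> i) (\<beta> i)"
    and j: "j \<in> {1..n}" and qj: "quad_at n {} g E0 B0 j a b c d"
  shows "compatible n f E0 (degree_weight n B0 j) (g_coord a b c d)"
    and "compatible n f E0 (\<lambda>l. - degree_weight n B0 j l) (\<lambda>p q. - g_coord a b c d p q)"
proof -
  note qd = quad_atD[OF qj]
  have wx: "degree_weight n B0 j i = of_bool (i = j)" if "i \<in> {1..n}" for i
  proof -
    have "(\<Sum>l=1..n. of_bool (i = n + l) * B0 j l) = 0"
      by (rule sum.neutral) (use that in auto)
    then show ?thesis by (simp add: degree_weight_def)
  qed
  \<comment> \<open>The grading gives \<open>y_i\<close> the weight \<open>- B0 j i\<close>;
    skew-symmetry turns it into an entry of column \<open>j\<close>, which is described by the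
    quadrilateral around \<open>j\<close>.\<close>
  have wy: "degree_weight n B0 j (n + i) = B0 i j" if "i \<in> {1..n}" for i
  proof -
    have "(\<Sum>l=1..n. of_bool (n + i = n + l) * B0 j l) = (\<Sum>l=1..n. if l = i then B0 j l else 0)"
      by (rule sum.cong) auto
    then show ?thesis using that j triangulation_skew[OF tri that j] by (simp add: degree_weight_def)
  qed
  have init: "of_bool (i = j) = g_coord a b c d p q" if i: "i \<in> {1..n}" "E0 i = {p, q}" for i p q
  proof (cases "i = j")
    case True
    then have "p = a \<and> q = c \<or> p = c \<and> q = a" using qd(2) i(2) by (metis doubleton_eq_iff)
    then show ?thesis using g_coord_diagonal[OF qd(1)] g_coord_swap True by auto
  next
    case False
    have "edge n E0 a c" using j qd(2) by (auto simp: edge_def)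
    then have "\<not> crosses p q a c" "\<not> crosses p q a b" "\<not> crosses p q b c" "\<not> crosses p q c d" "\<not> crosses p q d a"
      using edge_not_crosses[OF tri _ i] qd crosses_sym(1) by blast+
    moreover have "p \<noteq> q" by (rule diagonal_not_boundary(4)[OF tri i])
    moreover have "{p, q} \<noteq> {a, c}"
      using triangulation_inj[OF tri i(1) j] False i(2) qd(2) by metis
    ultimately show ?thesis using g_coord_not_crossing[OF qd(1)] False by simp
  qed
  have bd: "g_coord a b c d p q = 0" if "boundary n p q" for p q
    by (rule g_coord_boundary[OF qd(1,3-6) that])
  have sum1: "(\<Sum>i=1..n. max (shear (f (n + i)) P Q R S) 0 * degree_weight n B0 j (n + i)) =
      (\<Sum>i=1..n. max (shear (lamination (\<alpha> i) (\<beta> i)) P Q R S) 0 * B0 i j)"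
    and sum2: "(\<Sum>i=1..n. max (- shear (f (n + i)) P Q R S) 0 * degree_weight n B0 j (n + i)) =
      (\<Sum>i=1..n. max (- shear (lamination (\<alpha> i) (\<beta> i)) P Q R S) 0 * B0 i j)" for P Q R S
    by (rule sum.cong, simp_all add: f wy)+
  note pt = g_coord_ptolemy[OF tri E0 qj]
  show "compatible n f E0 (degree_weight n B0 j) (g_coord a b c d)"
    unfolding compatible_def
  proof (intro conjI allI impI ballI)
    fix P Q R S assume q: "quad P Q R S" "{P, Q, R, S} \<subseteq> {..n + 2}"
    show "2 * (g_coord a b c d P R + g_coord a b c d Q S) =
       min (2 * (g_coord a b c d P Q + g_coord a b c d R S) + (\<Sum>i=1..n. max (shear (f (n + i)) P Q R S) 0 * degree_weight n B0 j (n + i)))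
           (2 * (g_coord a b c d Q R + g_coord a b c d S P) + (\<Sum>i=1..n. max (- shear (f (n + i)) P Q R S) 0 * degree_weight n B0 j (n + i)))"
      unfolding sum1 sum2 using pt[OF q] by linarith
  qed (use g_coord_swap bd init wx in auto)
  show "compatible n f E0 (\<lambda>l. - degree_weight n B0 j l) (\<lambda>p q. - g_coord a b c d p q)"
    unfolding compatible_def
  proof (intro conjI allI impI ballI)
    fix P Q R S assume q: "quad P Q R S" "{P, Q, R, S} \<subseteq> {..n + 2}"
    show "2 * (- g_coord a b c d P R + - g_coord a b c d Q S) =
       min (2 * (- g_coord a b c d P Q + - g_coord a b c d R S) + (\<Sum>i=1..n. max (shear (f (n + i)) P Q R S) 0 * - degree_weight n B0 j (n + i)))
           (2 * (- g_coord a b c d Q R + - g_coord a b c d S P) + (\<Sum>i=1..n. max (- shear (f (n + i)) P Q R S) 0 * - degree_weight n B0 j (n + i)))"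
      unfolding mult_minus_right sum_negf sum1 sum2 using pt[OF q] by (simp add: min_def)
  qed (use g_coord_swap bd init wx in auto)
qed

section \<open>Chains in the quiver\<close>

lemma quiver_sum:
  assumes "B i j = - B j i"
  shows "quiver_of B i j + quiver_of B j i = nat \<bar>B i j\<bar>"
  using assms by (auto simp: quiver_of_def)

lemma chain_no_triangle:
  assumes "induces_chain Q S" "{x, y, z} \<subseteq> S"
    "Q x y + Q y x \<noteq> 0" "Q y z + Q z y \<noteq> 0" "Q x z + Q z x \<noteq> 0"
  shows False
proof -
  obtain vs where vs: "set vs = S" "\<And>i j. i < length vs \<Longrightarrow> j < length vs \<Longrightarrow>
      Q (vs ! i) (vs ! j) + Q (vs ! j) (vs ! i) = (if j = i + 1 \<or> i = j + 1 then 1 else 0)"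
    using assms(1) unfolding induces_chain_def by blast
  obtain i j k where "i < length vs" "vs ! i = x" "j < length vs" "vs ! j = y" "k < length vs" "vs ! k = z"
    using assms(2) vs(1) by (metis in_set_conv_nth insert_subset)
  then have "j = i + 1 \<or> i = j + 1" "k = j + 1 \<or> j = k + 1" "k = i + 1 \<or> i = k + 1"
    using vs(2)[of i j] vs(2)[of j k] vs(2)[of i k] assms(3-5) by (auto split: if_splits)
  then show False by linarith
qed

text \<open>With at most one neighbour in \<open>C\<close>, the vertex \<open>j\<close> is an end of
  the chain, and \<open>k\<close> can be attached there.\<close>

lemma chain_extend:
  assumes C: "induces_chain Q C" and j: "j \<in> C" "\<And>x y. x \<in> C \<Longrightarrow> y \<in> C \<Longrightarrow> Q x j + Q j x \<noteq> 0 \<Longrightarrow> Q y j + Q j y \<noteq> 0 \<Longrightarrow> x = y"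
    and k: "k \<notin> C" "Q k j + Q j k = 1" "\<And>i. i \<in> C \<Longrightarrow> i \<noteq> j \<Longrightarrow> Q k i + Q i k = 0" "Q k k = 0"
  shows "induces_chain Q (insert k C)"
proof -
  define chain where "chain vs \<longleftrightarrow> (\<forall>i<length vs. \<forall>j<length vs.
      Q (vs ! i) (vs ! j) + Q (vs ! j) (vs ! i) = (if j = i + 1 \<or> i = j + 1 then 1 else 0))" for vs
  obtain vs where vs: "vs \<noteq> []" "distinct vs" "set vs = C" "chain vs"
    using C unfolding induces_chain_def chain_def by blast
  have "\<exists>us. us \<noteq> [] \<and> distinct us \<and> set us = C \<and> chain us \<and> us ! 0 = j"
  proof -
    obtain m where m: "m < length vs" "vs ! m = j" using j(1) vs(3) by (metis in_set_conv_nth)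
    have "m = 0 \<or> m = length vs - 1"
    proof (rule ccontr)
      assume no: "\<not> ?thesis"
      have ch: "Q (vs ! i) (vs ! j) + Q (vs ! j) (vs ! i) = (if j = i + 1 \<or> i = j + 1 then 1 else 0)"
        if "i < length vs" "j < length vs" for i j
        using vs(4) that unfolding chain_def by blast
      from no have l: "m - 1 < length vs" "m + 1 < length vs" "0 < m" using m by auto
      have "Q (vs ! (m - 1)) j + Q j (vs ! (m - 1)) \<noteq> 0" "Q (vs ! (m + 1)) j + Q j (vs ! (m + 1)) \<noteq> 0"
        using ch[of "m - 1" m] ch[of "m + 1" m] l m by auto
      then have "vs ! (m - 1) = vs ! (m + 1)" using j(2) l vs(3) nth_mem by blast
      then show False using vs(2) l by (simp add: nth_eq_iff_index_eq)
    qed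
    \<comment> \<open>Reversal brings \<open>j\<close> to the front if it is the last
      vertex.\<close>
    moreover have "chain (rev vs)"
      unfolding chain_def
    proof (intro allI impI)
      fix i j assume ij: "i < length (rev vs)" "j < length (rev vs)"
      let ?i = "length vs - Suc i" and ?j = "length vs - Suc j"
      have "?i < length vs" "?j < length vs" using ij by auto
      then have "Q (vs ! ?i) (vs ! ?j) + Q (vs ! ?j) (vs ! ?i) = (if ?j = ?i + 1 \<or> ?i = ?j + 1 then 1 else 0)"
        using vs(4) unfolding chain_def by blast
      moreover have "(?j = ?i + 1 \<or> ?i = ?j + 1) = (j = i + 1 \<or> i = j + 1)" using ij by auto
      ultimately show "Q (rev vs ! i) (rev vs ! j) + Q (rev vs ! j) (rev vs ! i) = (if j = i + 1 \<or> i = j + 1 then 1 else 0)"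
        using ij by (simp add: rev_nth)
    qed
    moreover have "rev vs ! 0 = vs ! (length vs - 1)" using vs(1) by (simp add: rev_nth)
    ultimately show ?thesis using vs m(2) by (metis distinct_rev rev_is_Nil_conv set_rev)
  qed
  then obtain us where us: "us \<noteq> []" "distinct us" "set us = C" "chain us" "us ! 0 = j" by blast
  have e: "Q k (us ! i) + Q (us ! i) k = (if i = 0 then 1 else 0)" if "i < length us" for i
  proof (cases "i = 0")
    case False
    then have "us ! i \<noteq> j" using us that nth_eq_iff_index_eq by (metis length_greater_0_conv)
    then show ?thesis using k(3)[of "us ! i"] us(3) that False by auto
  qed (use us(5) k(2) in simp)
  have "chain (k # us)"
    unfolding chain_def
  proof (intro allI impI)
    fix i l assume il: "i < length (k # us)" "l < length (k # us)"
    show "Q ((k # us) ! i) ((k # us) ! l) + Q ((k # us) ! l) ((k # us) ! i) = (if l = i + 1 \<or> i = l + 1 then 1 else 0)"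
    proof (cases i)
      case 0
      then show ?thesis using e il k(4) by (cases l) auto
    next
      case (Suc i')
      show ?thesis
      proof (cases l)
        case 0
        then show ?thesis using e[of i'] il Suc by (simp add: add.commute)
      next
        case (Suc l')
        then show ?thesis using us(4) il \<open>i = Suc i'\<close> unfolding chain_def by simp
      qed
    qed
  qed
  then show ?thesis
    unfolding induces_chain_def chain_def
    using us(2,3) k(1) by (intro exI[of _ "k # us"]) auto
qed

section \<open>Shear coordinates of \<open>pq\<close> in terms of the set \<open>C\<close> of
  crossed initial diagonals\<close>

context
  fixes n g E0 B0 C p q k a b c d
  assumes tri: "triangulation n {} g E0 B0" and C: "C \<subseteq> {1..n}"
    and cross: "\<And>i u v. i \<in> {1..n} \<Longrightarrow> E0 i = {u, v} \<Longrightarrow> crossing u v p q = (if i \<in> C then 1 else 0)"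
    and pq: "p \<le> n + 2" "q \<le> n + 2"
    and k: "k \<in> {1..n}" and qk: "quad_at n {} g E0 B0 k a b c d"
begin

lemmas qd = quad_atD[OF qk]

lemma in_C_iff: "i \<in> {1..n} \<Longrightarrow> E0 i = {u, v} \<Longrightarrow> i \<in> C \<longleftrightarrow> crosses u v p q"
  using cross[of i u v] by (auto simp: crossing_def split: if_splits)

lemma crossed_edge:
  assumes "edge n E0 u v" "crosses u v p q"
  obtains i where "i \<in> C" "i \<in> {1..n}" "E0 i = {u, v}"
proof -
  have "\<not> boundary n u v" using assms(2) boundary_not_crosses pq by blast
  then show thesis using assms in_C_iff that unfolding edge_def by blast
qed

lemma arrow_iff:
  assumes "j \<in> {1..n}"
  shows "has_arrow (quiver_of B0) k j \<longleftrightarrow> E0 j = {a, b} \<or> E0 j = {c, d}"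
proof -
  have "B0 j k = of_bool (E0 j = {a, b}) + of_bool (E0 j = {c, d}) - of_bool (E0 j = {b, c}) - of_bool (E0 j = {d, a})"
    using qk assms by (simp add: quad_at_def)
  from trans[OF this sides_sign[OF qd(11)]] have "0 < B0 j k \<longleftrightarrow> E0 j = {a, b} \<or> E0 j = {c, d}"
    by (metis (full_types) neg_0_less_iff_less not_one_less_zero zero_less_one less_irrefl)
  moreover have "B0 k j = - B0 j k" by (rule triangulation_skew[OF tri k assms])
  ultimately show ?thesis by (auto simp: has_arrow_def quiver_of_def)
qed

text \<open>If \<open>pq\<close> crosses \<open>ac\<close>, its ends lie strictly on the two sides
  of \<open>ac\<close>. One end is in the arc of \<open>ab\<close> iff \<open>pq\<close> crosses
  \<open>ab\<close>, the other in that of \<open>cd\<close> iff it crosses \<open>cd\<close>: the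
  vertices \<open>b\<close> and \<open>d\<close> belong to the arcs of \<open>bc\<close> and
  \<open>da\<close>. Both, one or none of these crossings give 1, 0 or -1, and the crossed ones
  among \<open>ab\<close> and \<open>cd\<close> are the arrows from \<open>k\<close> into
  \<open>C\<close>.\<close>

lemma g_formula_inside:
  assumes "k \<in> C"
  shows "g_coord a b c d p q = int (card {j \<in> C. has_arrow (quiver_of B0) k j}) - 1"
proof -
  have card1: "int (card {j \<in> C. E0 j = {u, v}}) = (if crosses u v p q then 1 else 0)" if e: "edge n E0 u v" for u v
  proof (cases "crosses u v p q")
    case True
    obtain i where i: "i \<in> C" "i \<in> {1..n}" "E0 i = {u, v}" by (rule crossed_edge[OF e True])
    have "j \<in> C \<and> E0 j = {u, v} \<longleftrightarrow> j = i" for j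
      using i C triangulation_inj[OF tri _ i(2), of j] by (metis subsetD)
    then show ?thesis using True by simp
  next
    case False
    then have none: "{j \<in> C. E0 j = {u, v}} = {}" using in_C_iff C by blast
    show ?thesis unfolding none using False by simp
  qed
  have ne: "{a, b} \<noteq> {c, d}" using qd(11) by (auto simp: doubleton_eq_iff)
  have "{j \<in> C. has_arrow (quiver_of B0) k j} = {j \<in> C. E0 j = {a, b}} \<union> {j \<in> C. E0 j = {c, d}}"
    using arrow_iff C by blast
  moreover have "finite C" using C finite_subset by blast
  ultimately have "card {j \<in> C. has_arrow (quiver_of B0) k j} = card {j \<in> C. E0 j = {a, b}} + card {j \<in> C. E0 j = {c, d}}"
    using ne by (simp add: card_Un_disjoint disjoint_iff)
  then have "int (card {j \<in> C. has_arrow (quiver_of B0) k j}) =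
      (if crosses a b p q then 1 else 0) + (if crosses c d p q then 1 else 0)"
    using card1[OF qd(7)] card1[OF qd(9)] by simp
  moreover have "crosses a c p q" using in_C_iff[OF k qd(2)] assms by simp
  then have "g_coord a b c d p q = (if crosses a b p q then 1 else 0) + (if crosses c d p q then 1 else 0) - 1"
    using qd(1) unfolding quad_def crosses_def g_coord_def arc_def cyc_def by (smt (verit))
  ultimately show ?thesis by simp
qed

text \<open>Having crossed \<open>cd\<close>, the diagonal \<open>pq\<close> enters the triangle
  \<open>acd\<close> and must end at \<open>a\<close>. So \<open>cd\<close> is the last crossed
  diagonal, hence an end of the chain, and no other element of \<open>C\<close> is adjacent to
  \<open>k\<close>.\<close>

lemma chain_insert:
  assumes kC: "k \<notin> C" and ch: "induces_chain (quiver_of B0) C"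
    and cr: "crosses c d p q" "\<not> crosses a c p q" "\<not> crosses a b p q" "\<not> crosses b c p q" "\<not> crosses d a p q"
  shows "induces_chain (quiver_of B0) (insert k C)" "\<exists>j\<in>C. has_arrow (quiver_of B0) k j"
proof -
  obtain j where j: "j \<in> C" "j \<in> {1..n}" "E0 j = {c, d}" by (rule crossed_edge[OF qd(9) cr(1)])
  show "\<exists>j\<in>C. has_arrow (quiver_of B0) k j" using arrow_iff[OF j(2)] j(1,3) by blast
  note qk' = quad_at_rotate[OF qk]
  obtain e where qj: "quad_at n {} g E0 B0 j c e d a" using quad_at_side_ab(1)[OF tri k j(2) qk' j(3)] by blast
  have bjk: "B0 j k = 1" by (rule quad_at_side_ab(2)[OF tri k j(2) qk' j(3)])
  note qjd = quad_atD[OF qj]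
  have skew: "B0 x y = - B0 y x" if "x \<in> {1..n}" "y \<in> {1..n}" for x y
    by (rule triangulation_skew[OF tri that])
  \<comment> \<open>A line through one side of a triangle leaves it through at most one of the other
    two, so \<open>j\<close> has at most one neighbour in \<open>C\<close>.\<close>
  have one: "\<not> (crosses c e p q \<and> crosses e d p q)"
    using qjd(1) cr(1) unfolding quad_def crosses_def cyc_def by (smt (verit))
  show "induces_chain (quiver_of B0) (insert k C)"
  proof (rule chain_extend[OF ch j(1)])
    have nb: "E0 x = {c, e} \<and> crosses c e p q \<or> E0 x = {e, d} \<and> crosses e d p q"
      if x: "x \<in> C" "quiver_of B0 x j + quiver_of B0 j x \<noteq> 0" for x
    proof -
      have xn: "x \<in> {1..n}" using x C by blast
      have "B0 x j \<noteq> 0" using x(2) quiver_sum[of B0, OF skew[OF xn j(2)]] by auto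
      moreover have "B0 x j = of_bool (E0 x = {c, e}) + of_bool (E0 x = {d, a}) - of_bool (E0 x = {e, d}) - of_bool (E0 x = {a, c})"
        using qj xn by (simp add: quad_at_def)
      ultimately have "E0 x = {c, e} \<or> E0 x = {d, a} \<or> E0 x = {e, d} \<or> E0 x = {a, c}"
        using sides_sign[OF qjd(11), of "E0 x"] by (metis (full_types))
      then show ?thesis using in_C_iff[OF xn] x(1) cr by blast
    qed
    fix x y assume xy: "x \<in> C" "y \<in> C" "quiver_of B0 x j + quiver_of B0 j x \<noteq> 0" "quiver_of B0 y j + quiver_of B0 j y \<noteq> 0"
    have "E0 x = E0 y" using nb[OF xy(1,3)] nb[OF xy(2,4)] one by metis
    then show "x = y" using triangulation_inj[OF tri] xy(1,2) C by blast
  next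
    show "k \<notin> C" by (rule kC)
    show "quiver_of B0 k j + quiver_of B0 j k = 1"
      using quiver_sum[of B0, OF skew[OF k j(2)]] skew[OF k j(2)] bjk by simp
    show "quiver_of B0 k k = 0" using skew[OF k k] by (simp add: quiver_of_def)
    fix i assume i: "i \<in> C" "i \<noteq> j"
    then have xn: "i \<in> {1..n}" using C by blast
    have "E0 i \<noteq> {c, d}" using triangulation_inj[OF tri xn j(2)] i(2) j(3) by auto
    moreover have "E0 i \<noteq> {a, b}" "E0 i \<noteq> {b, c}" "E0 i \<noteq> {d, a}"
      using in_C_iff[OF xn] i(1) cr by blast+
    moreover have "B0 i k = of_bool (E0 i = {a, b}) + of_bool (E0 i = {c, d}) - of_bool (E0 i = {b, c}) - of_bool (E0 i = {d, a})"
      using qk xn by (simp add: quad_at_def)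
    ultimately have "B0 i k = 0" by simp
    then show "quiver_of B0 k i + quiver_of B0 i k = 0"
      using quiver_sum[of B0, OF skew[OF k xn]] skew[OF k xn] by simp
  qed
qed

text \<open>Past \<open>cd\<close>, the diagonal \<open>pq\<close> either ends at \<open>a\<close>,
  where the coordinate is 1, or leaves through \<open>da\<close>. In the latter case
  \<open>da\<close> is in \<open>C\<close>, and the sides of the triangle \<open>acd\<close> form a
  3-cycle inside the supposed chain.\<close>

lemma g_coord_from_chain:
  assumes kC: "k \<notin> C" and ch: "induces_chain (quiver_of B0) (insert k C)" and j: "j \<in> C" "E0 j = {c, d}"
  shows "g_coord a b c d p q = 1"
proof (rule ccontr)
  assume no: "g_coord a b c d p q \<noteq> 1"
  have jn: "j \<in> {1..n}" using j C by blast
  have cd: "crosses c d p q" using in_C_iff[OF jn j(2)] j(1) by simp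
  have ac: "\<not> crosses a c p q" using in_C_iff[OF k qd(2)] kC by simp
  have "crosses d a p q"
    using no cd ac qd(1) unfolding quad_def crosses_def g_coord_def arc_def cyc_def by (smt (verit))
  then obtain i where i: "i \<in> C" "i \<in> {1..n}" "E0 i = {d, a}" by (rule crossed_edge[OF qd(10)])
  note qk' = quad_at_rotate[OF qk]
  obtain e where qj: "quad_at n {} g E0 B0 j c e d a" using quad_at_side_ab(1)[OF tri k jn qk' j(2)] by blast
  have bjk: "B0 j k = 1" by (rule quad_at_side_ab(2)[OF tri k jn qk' j(2)])
  have bik: "B0 i k = -1" by (rule quad_at_side_bc(2)[OF tri k i(2) qk' i(3)])
  have bij: "B0 i j = 1" by (rule quad_at_side_ab(2)[OF tri jn i(2) quad_at_rotate[OF qj] i(3)])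
  note s = triangulation_skew[OF tri]
  show False
  proof (rule chain_no_triangle[OF ch, of i j k])
    show "{i, j, k} \<subseteq> insert k C" using i j by simp
    show "quiver_of B0 i j + quiver_of B0 j i \<noteq> 0"
      using quiver_sum[of B0, OF s[OF i(2) jn]] bij by simp
    show "quiver_of B0 j k + quiver_of B0 k j \<noteq> 0"
      using quiver_sum[of B0, OF s[OF jn k]] bjk by simp
    show "quiver_of B0 i k + quiver_of B0 k i \<noteq> 0"
      using quiver_sum[of B0, OF s[OF i(2) k]] bik by simp
  qed
qed

end

lemma g_formula:
  assumes tri: "triangulation n {} g E0 B0" and C: "C \<subseteq> {1..n}"
    and cross: "\<And>i u v. i \<in> {1..n} \<Longrightarrow> E0 i = {u, v} \<Longrightarrow> crossing u v p q = (if i \<in> C then 1 else 0)"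
    and pq: "p \<le> n + 2" "q \<le> n + 2"
    and k: "k \<in> {1..n}" and qk: "quad_at n {} g E0 B0 k a b c d"
    and ch: "induces_chain (quiver_of B0) C"
  shows "g_coord a b c d p q =
    (if k \<in> C then int (card {j \<in> C. has_arrow (quiver_of B0) k j}) - 1
     else if induces_chain (quiver_of B0) (insert k C) \<and> (\<exists>j\<in>C. has_arrow (quiver_of B0) k j) then 1
     else 0)"
proof (cases "k \<in> C")
  case True
  then show ?thesis using g_formula_inside[OF tri C cross pq k qk] by simp
next
  case False
  note qd = quad_atD[OF qk]
  note qk' = quad_at_rotate[OF qk]
  have ac: "\<not> crosses a c p q" using in_C_iff[OF tri C cross pq k qk k qd(2)] False by simp
  have ne: "\<not> (p = a \<and> q = c)" "\<not> (p = c \<and> q = a)"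
    using cross[OF k qd(2)] False by (auto simp: crossing_def)
  \<comment> \<open>Ends in the arcs \<open>[b, c)\<close> and \<open>[d, a)\<close> lie strictly on
    different sides of \<open>ac\<close> and would force a crossing.\<close>
  have m1: "g_coord a b c d p q \<noteq> -1"
    using ac qd(1) unfolding quad_def crosses_def g_coord_def arc_def cyc_def by (smt (verit))
  show ?thesis
  proof (cases "g_coord a b c d p q = 1")
    case True
    \<comment> \<open>Ends in \<open>[a, b)\<close> and \<open>[c, d)\<close> without a crossing of
      \<open>ac\<close> mean that one end is \<open>a\<close> or \<open>c\<close>, but not both,
      since \<open>pq\<close> is not \<open>ac\<close>. From \<open>a\<close> only the side
      \<open>cd\<close> is crossed, from \<open>c\<close> only \<open>ab\<close>.\<close>
    then have "crosses c d p q \<and> \<not> crosses a b p q \<and> \<not> crosses b c p q \<and> \<not> crosses d a p q \<or>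
        crosses a b p q \<and> \<not> crosses c d p q \<and> \<not> crosses b c p q \<and> \<not> crosses d a p q"
      using ac ne qd(1) unfolding quad_def crosses_def g_coord_def arc_def cyc_def by (smt (verit))
    then have "induces_chain (quiver_of B0) (insert k C) \<and> (\<exists>j\<in>C. has_arrow (quiver_of B0) k j)"
      using chain_insert[OF tri C cross pq k qk False ch] chain_insert[OF tri C cross pq k qk' False ch]
        ac crosses_sym(2)[of c a] by blast
    then show ?thesis using True False by simp
  next
    case ng: False
    have "\<not> (induces_chain (quiver_of B0) (insert k C) \<and> (\<exists>j\<in>C. has_arrow (quiver_of B0) k j))"
    proof
      assume *: "induces_chain (quiver_of B0) (insert k C) \<and> (\<exists>j\<in>C. has_arrow (quiver_of B0) k j)"
      then obtain j where j: "j \<in> C" "has_arrow (quiver_of B0) k j" by blast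
      then have "E0 j = {a, b} \<or> E0 j = {c, d}" using arrow_iff[OF tri C cross pq k qk] C by blast
      then show False
        using g_coord_from_chain[OF tri C cross pq k qk False _ j(1)] g_coord_from_chain[OF tri C cross pq k qk' False _ j(1)]
          * ng g_coord_rotate by metis
    qed
    moreover have "g_coord a b c d p q \<in> {1, 0, -1}" by (simp add: g_coord_def)
    then have "g_coord a b c d p q = 0" using m1 ng by blast
    ultimately show ?thesis using False by simp
  qed
qed

theorem proposition7p13:
  fixes n :: nat and B0 :: imat and Q0 :: quiver and C :: "nat set" and z :: ratfun
  assumes "exchange_matrix_type_A n B0"
    and "Q0 = quiver_of B0"
    and "C \<noteq> {}" and "C \<subseteq> {1..n}" and "induces_chain Q0 C"
    and "z \<in> cluster_variables n B0"
    and "has_denominator_vector n z (\<lambda>i. if i \<in> C then 1 else 0)"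
  shows "has_g_vector n B0 z (\<lambda>k.
           if k \<in> C then int (card {j \<in> C. has_arrow Q0 k j}) - 1
           else if induces_chain Q0 (insert k C) \<and> (\<exists>j\<in>C. has_arrow Q0 k j) then 1
           else 0)"
proof -
  obtain E0 where tri: "triangulation n {} undefined E0 B0"
    by (rule exchange_matrix_type_A_triangulation[OF assms(1)])
  have "\<forall>i\<in>{1..n}. \<exists>u v. E0 i = {u, v}"
    using diagonal_obtain[OF tri] by metis
  then obtain \<alpha> \<beta> where E0: "\<forall>i\<in>{1..n}. E0 i = {\<alpha> i, \<beta> i}" by metis
  define f where "f r = lamination (\<alpha> (r - n)) (\<beta> (r - n))" for r
  have f: "f (n + i) = lamination (\<alpha> i) (\<beta> i)" for i by (simp add: f_def)
  obtain t j where t: "t \<in> tree_vertices n" "j \<in> {1..n}" "z = fst (seed_at n B0 t) j"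
    using assms(6) unfolding cluster_variables_def by blast
  have "seed_model n f E0 (seed_at n B0 t)"
    by (rule seed_model_seed_at[OF tri bspec[OF E0] f]) (use t(1) in \<open>auto simp: tree_vertices_def\<close>)
  then obtain E where E: "triangulation n {n+1..n+n} f E (snd (seed_at n B0 t))"
    and val: "\<And>w F p q. compatible n f E0 w F \<Longrightarrow> E j = {p, q} \<Longrightarrow> val w z = F p q"
    unfolding seed_model_def using t(2,3) by blast
  obtain p q where pq: "E j = {p, q}" "p < q" "q \<le> n + 2" by (rule diagonal_obtain[OF E t(2)])
  have n: "1 \<le> n" using t(2) by simp
  have den: "val (\<lambda>l. of_bool (l = i)) z = - (if i \<in> C then 1 else 0)" if "i \<in> {1..n}" for i
    using has_denominator_vectorE[OF assms(7) n] that by metis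
  \<comment> \<open>The given denominator vector thus identifies \<open>C\<close> as the set of
    initial diagonals crossed by \<open>pq\<close>. As no value is -1, \<open>pq\<close> itself is
    not an initial diagonal.\<close>
  have cross: "crossing u v p q = (if i \<in> C then 1 else 0)" if i: "i \<in> {1..n}" "E0 i = {u, v}" for i u v
    using val[OF compatible_crossing[OF tri i] pq(1)] den[OF i(1)] by simp
  show ?thesis
  proof (rule has_g_vectorI[OF assms(7) n])
    fix k assume k: "k \<in> {1..n}"
    obtain a b c d where qk: "quad_at n {} undefined E0 B0 k a b c d" by (rule triangulation_quad[OF tri k])
    have g: "g_coord a b c d p q = (if k \<in> C then int (card {j \<in> C. has_arrow Q0 k j}) - 1
           else if induces_chain Q0 (insert k C) \<and> (\<exists>j\<in>C. has_arrow Q0 k j) then 1 else 0)"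
      using g_formula[OF tri assms(4) cross _ _ k qk] assms(2,5) pq(2,3) by simp
    show "val (degree_weight n B0 k) z = (if k \<in> C then int (card {j \<in> C. has_arrow Q0 k j}) - 1
           else if induces_chain Q0 (insert k C) \<and> (\<exists>j\<in>C. has_arrow Q0 k j) then 1 else 0)"
      unfolding g[symmetric] by (rule val[OF compatible_g_coord(1)[OF tri E0 f k qk] pq(1)])
    show "val (\<lambda>l. - degree_weight n B0 k l) z = - (if k \<in> C then int (card {j \<in> C. has_arrow Q0 k j}) - 1
           else if induces_chain Q0 (insert k C) \<and> (\<exists>j\<in>C. has_arrow Q0 k j) then 1 else 0)"
      unfolding g[symmetric] by (rule val[OF compatible_g_coord(2)[OF tri E0 f k qk] pq(1)])
  qed
qed

end
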